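(* For any constant $\sigma\in(0,1)$ there exists a constant $\tilde{\tau}\in(0,1)$ with the following property: if there are $k_0\in\mathbb{N}$ with $k_0\geq 3$ and a polynomial time $\tilde{\tau}\cdot(k+1)$-approximation algorithm for the unweighted $k$-Set Packing problem for every $k\geq k_0$, then there is a polynomial time $(1+\sigma\cdot(k-1))$-approximation algorithm for the weighted $k$-Set Packing problem for every $k\geq k_0$.
   Context: The weighted $k$-Set Packing problem: given a finite collection $\mathcal{S}$ of sets, each of cardinality at most $k$, and a weight function $w:\mathcal{S}\to\mathbb{Q}_{>0}$, find a sub-collection of pairwise disjoint sets of maximum total weight. The unweighted $k$-Set Packing problem is the special case $w\equiv 1$. An $r$-approximation algorithm always returns a feasible solution whose objective value is at least $1/r$ times the optimum. $k$ is treated as a constant for running times. *)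

theory Defs
  imports Complex_Main "HOL-Library.Log_Nat" "HOL-Computational_Algebra.Polynomial"
begin

section \<open>Polynomial-time computation\<close>

text \<open>
  The model of computation is a deterministic while language on binary trees of natural numbers
  with bit cost. An atomic operation is charged the binary size of its operand plus that of its
  result, so time \<^term>\<open>t\<close> also bounds the space taken by every value that occurs in the run.
  Running times in this model and on Turing machines are therefore polynomially related.
\<close>

datatype val = Num nat | Pair val val

text \<open>\<^term>\<open>floorlog 2 n\<close> is the number of binary digits of \<^term>\<open>n\<close>, and is 0 for \<^term>\<open>n = 0\<close>.\<close>

fun vsize :: "val \<Rightarrow> nat" where
  "vsize (Num n) = 1 + floorlog 2 n"
| "vsize (Pair u v) = 1 + vsize u + vsize v"

datatype atom = Id | Const val | Fst | Snd | IsPair | Add | Sub | Mul | Div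

text \<open>All operations are total: ill-formed operands yield \<^term>\<open>Num 0\<close>. Subtraction is
  truncated, and division is Euclidean.\<close>

fun apply_atom :: "atom \<Rightarrow> val \<Rightarrow> val" where
  "apply_atom Id x = x"
| "apply_atom (Const v) x = v"
| "apply_atom Fst (Pair u v) = u"
| "apply_atom Snd (Pair u v) = v"
| "apply_atom IsPair (Pair u v) = Num 1"
| "apply_atom Add (Pair (Num m) (Num n)) = Num (m + n)"
| "apply_atom Sub (Pair (Num m) (Num n)) = Num (m - n)"
| "apply_atom Mul (Pair (Num m) (Num n)) = Num (m * n)"
| "apply_atom Div (Pair (Num m) (Num n)) = Num (m div n)"
| "apply_atom _ _ = Num 0"

datatype prog =
    Atom atom
  | Seq prog prog
  | Fork prog prog
  | If prog prog prog
  | While prog prog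

text \<open>\<^term>\<open>runs p x y t\<close>: on input \<^term>\<open>x\<close>, the program \<^term>\<open>p\<close> halts with output \<^term>\<open>y\<close>
  after time \<^term>\<open>t\<close>. \<^term>\<open>Fork p q\<close> runs both programs on the same input and pairs their
  outputs. In tests, \<^term>\<open>Num 0\<close> is false and every other value is true.\<close>

inductive runs :: "prog \<Rightarrow> val \<Rightarrow> val \<Rightarrow> nat \<Rightarrow> bool" where
  atom: "runs (Atom f) x (apply_atom f x) (vsize x + vsize (apply_atom f x))"
| seq: "runs p x y s \<Longrightarrow> runs q y z t \<Longrightarrow> runs (Seq p q) x z (s + t + 1)"
| fork: "runs p x y s \<Longrightarrow> runs q x z t \<Longrightarrow> runs (Fork p q) x (Pair y z) (s + t + 1)"
| if_true: "runs c x v s \<Longrightarrow> v \<noteq> Num 0 \<Longrightarrow> runs p x y t \<Longrightarrow> runs (If c p q) x y (s + t + 1)"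
| if_false: "runs c x (Num 0) s \<Longrightarrow> runs q x y t \<Longrightarrow> runs (If c p q) x y (s + t + 1)"
| while_true: "runs c x v s \<Longrightarrow> v \<noteq> Num 0 \<Longrightarrow> runs p x y t \<Longrightarrow> runs (While c p) y z u \<Longrightarrow>
    runs (While c p) x z (s + t + u + 1)"
| while_false: "runs c x (Num 0) s \<Longrightarrow> runs (While c p) x x (s + 1)"

inductive_cases runs_AtomE: "runs (Atom f) x y t"
inductive_cases runs_SeqE: "runs (Seq p q) x y t"
inductive_cases runs_ForkE: "runs (Fork p q) x y t"
inductive_cases runs_IfE: "runs (If c p q) x y t"
inductive_cases runs_WhileE: "runs (While c p) x y t"

lemma runs_deterministic:
  "runs p x y t \<Longrightarrow> runs p x y' t' \<Longrightarrow> y' = y \<and> t' = t"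
proof (induction arbitrary: y' t' rule: runs.induct)
  case (atom f x) then show ?case by (auto elim: runs_AtomE)
next
  case (seq p x y s q z t)
  from seq.prems show ?case by (rule runs_SeqE) (auto dest!: seq.IH)
next
  case (fork p x y s q z t)
  from fork.prems show ?case by (rule runs_ForkE) (auto dest!: fork.IH)
next
  case (if_true c x v s p y t q)
  from if_true.prems show ?case by (rule runs_IfE) (use if_true.hyps in \<open>auto dest!: if_true.IH\<close>)
next
  case (if_false c x s q y t p)
  from if_false.prems show ?case by (rule runs_IfE) (auto dest!: if_false.IH)
next
  case (while_true c x v s p y t z u)
  from while_true.prems show ?case by (rule runs_WhileE) (use while_true.hyps in \<open>auto dest!: while_true.IH\<close>)
next
  case (while_false c x s p)
  from while_false.prems show ?case by (rule runs_WhileE) (auto dest!: while_false.IH)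
qed

lemma vsize_le_time:
  "runs p x y t \<Longrightarrow> vsize x \<le> t \<and> vsize y \<le> t"
  by (induction rule: runs.induct) auto

section \<open>Weighted set packing\<close>

text \<open>An instance is a pair of a collection of sets and a weight function, of which only the
  values on the collection matter. Ground elements are natural numbers, so that they can be
  written down in the input.\<close>

type_synonym inst = "nat set set \<times> (nat set \<Rightarrow> rat)"

definition weighted_instances :: "nat \<Rightarrow> inst set" where
  "weighted_instances k =
    {(S, w). finite S \<and> (\<forall>s\<in>S. finite s \<and> card s \<le> k) \<and> (\<forall>s\<in>S. 0 < w s)}"

definition unweighted_instances :: "nat \<Rightarrow> inst set" where
  "unweighted_instances k = {(S, w). (S, w) \<in> weighted_instances k \<and> (\<forall>s\<in>S. w s = 1)}"

definition packings :: "nat set set \<Rightarrow> nat set set set" where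
  "packings S = {A. A \<subseteq> S \<and> pairwise disjnt A}"

definition opt :: "inst \<Rightarrow> rat" where
  "opt I = (case I of (S, w) \<Rightarrow> Max ((\<lambda>A. \<Sum>s\<in>A. w s) ` packings S))"

section \<open>Encodings\<close>

fun enc_list :: "val list \<Rightarrow> val" where
  "enc_list [] = Num 0"
| "enc_list (v # vs) = Pair v (enc_list vs)"

definition enc_set :: "nat set \<Rightarrow> val" where
  "enc_set s = enc_list (map Num (sorted_list_of_set s))"

text \<open>Weights are written as reduced fractions; only nonnegative rationals are encoded.\<close>

definition enc_rat :: "rat \<Rightarrow> val" where
  "enc_rat r = (case quotient_of r of (a, b) \<Rightarrow> Pair (Num (nat a)) (Num (nat b)))"

text \<open>A collection may be listed in any order, so it has several encodings.\<close>

definition encodes_instance :: "val \<Rightarrow> inst \<Rightarrow> bool" where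
  "encodes_instance x I \<longleftrightarrow> (case I of (S, w) \<Rightarrow>
    \<exists>ss. distinct ss \<and> set ss = S \<and> x = enc_list (map (\<lambda>s. Pair (enc_set s) (enc_rat (w s))) ss))"

definition encodes_collection :: "val \<Rightarrow> nat set set \<Rightarrow> bool" where
  "encodes_collection y A \<longleftrightarrow> (\<exists>ss. distinct ss \<and> set ss = A \<and> y = enc_list (map enc_set ss))"

section \<open>Approximation algorithms\<close>

definition approximation_algorithm :: "inst set \<Rightarrow> real \<Rightarrow> prog \<Rightarrow> bool" where
  "approximation_algorithm C r p \<longleftrightarrow>
    (\<forall>(S, w)\<in>C. \<forall>x. encodes_instance x (S, w) \<longrightarrow>
      (\<exists>y t A. runs p x y t \<and> encodes_collection y A \<and> A \<in> packings S \<and>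
        real_of_rat (\<Sum>s\<in>A. w s) \<ge> 1 / r * real_of_rat (opt (S, w))))"

definition polynomial_time :: "inst set \<Rightarrow> prog \<Rightarrow> bool" where
  "polynomial_time C p \<longleftrightarrow>
    (\<exists>q :: nat poly. \<forall>I\<in>C. \<forall>x. encodes_instance x I \<longrightarrow>
      (\<exists>y t. runs p x y t \<and> t \<le> poly q (vsize x)))"

end

theory Submission imports Defs begin

text \<open>
  Round the weights to integers between 0 and the number \<open>n\<close> of sets, and improve a packing \<open>A\<close> by
  local search with respect to its squared weight. For each threshold \<open>\<theta>\<close>, the unweighted algorithm
  is run on the sets \<open>s\<close> whose weight lies in \<open>[\<theta>, 2\<theta>)\<close> and whose neighbours in \<open>A\<close> have total weight at
  most \<open>C * w s\<close>; its output replaces its neighbours in \<open>A\<close> if this increases the squared weight.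
  In a local optimum, the sets of a packing \<open>B\<close> whose neighbourhood is too heavy have weight at most
  \<open>(k / C) * w A\<close>. If \<open>X\<close> is the output for \<open>\<theta>\<close>, then the neighbours of \<open>X\<close> that are much lighter than \<open>\<theta>\<close>
  account for at most half of its squared weight, so \<open>\<theta> * |X|\<close> is bounded by the
  weight of the part of \<open>A\<close> whose weights are within a factor \<open>2 C\<close> of \<open>\<theta>\<close>. Summing over
  dyadic \<open>\<theta>\<close> counts each element of \<open>A\<close> a number of times that depends on \<open>C\<close> only, so
  that the rest of \<open>B\<close> has weight at most \<open>O(C\<^sup>3) * \<tau> * (k + 1) * w A\<close>. Choose \<open>C \<ge> 4 / \<sigma>\<close> and then \<open>\<tau>\<close> small.
\<close>

section \<open>Polynomial-time functions\<close>

text \<open>The domain \<open>D\<close> is a promise: outside it the program may diverge. The given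
  solver is guaranteed to halt only on encodings of unweighted instances, so every closure lemma has
  to track such a domain.\<close>

definition polytime :: "val set \<Rightarrow> (val \<Rightarrow> val) \<Rightarrow> bool" where
  "polytime D f \<longleftrightarrow> (\<exists>p. \<exists>q :: nat poly. \<forall>x\<in>D. \<exists>t. runs p x (f x) t \<and> t \<le> poly q (vsize x))"

lemma polytimeI:
  fixes q :: "nat poly"
  assumes "\<And>x. x \<in> D \<Longrightarrow> \<exists>t. runs p x (f x) t \<and> t \<le> poly q (vsize x)"
  shows "polytime D f"
  using assms unfolding polytime_def by blast

lemma polytimeE:
  assumes "polytime D f"
  obtains p and q :: "nat poly"
  where "\<And>x. x \<in> D \<Longrightarrow> \<exists>t. runs p x (f x) t \<and> t \<le> poly q (vsize x)"
  using assms unfolding polytime_def by blast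

text \<open>A run is charged for its output, so its time also bounds the size of the output.\<close>

lemma polytime_vsize:
  assumes "polytime D f"
  obtains q :: "nat poly" where "\<And>x. x \<in> D \<Longrightarrow> vsize (f x) \<le> poly q (vsize x)"
  using assms by (elim polytimeE) (meson le_trans vsize_le_time)

lemma poly_nat_mono: "m \<le> n \<Longrightarrow> poly q m \<le> poly (q :: nat poly) n"
  by (induction q) (auto intro!: mult_le_mono)

section \<open>Growth of binary size under arithmetic\<close>

lemma floorlog_less: "n < 2 ^ floorlog 2 n"
  using floorlog_bounds[of n 2] by (cases "n = 0") auto

lemma vsize_Num_add: "vsize (Num (m + n)) \<le> vsize (Num m) + vsize (Num n)"
proof -
  have "m + n < 2 ^ floorlog 2 m + 2 ^ floorlog 2 n"
    using floorlog_less[of m] floorlog_less[of n] by simp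
  also have "\<dots> \<le> (2::nat) ^ (floorlog 2 m + floorlog 2 n + 1)"
    by (simp add: power_add mult_2 add_mono)
  finally have "floorlog 2 (m + n) \<le> floorlog 2 m + floorlog 2 n + 1"
    by (intro floorlog_leI) auto
  then show ?thesis by simp
qed

lemma floorlog_mult_le: "floorlog 2 (m * n) \<le> floorlog 2 m + floorlog 2 n"
proof (intro floorlog_leI)
  show "m * n < 2 ^ (floorlog 2 m + floorlog 2 n)"
    using floorlog_less[of m] floorlog_less[of n] by (simp add: power_add mult_strict_mono)
qed auto

text \<open>No atom more than adds a constant to the size; for \<open>Mul\<close> this holds because
  binary lengths add under multiplication.\<close>

lemma vsize_apply_atom:
  obtains c where "\<And>x. vsize (apply_atom a x) \<le> vsize x + c"
proof
  fix x
  \<comment> \<open>Four successors are what remains of the size of the operand pair plus 2 after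
    the size of the result loses its own 1.\<close>
  have "floorlog 2 (m - n) \<le> Suc (Suc (Suc (Suc (floorlog 2 m + floorlog 2 n))))"
    "floorlog 2 (m div n) \<le> Suc (Suc (Suc (Suc (floorlog 2 m + floorlog 2 n))))" for m n
    using floorlog_mono[of "m - n" m 2] floorlog_mono[of "m div n" m 2] by simp_all
  moreover have "floorlog 2 (Suc 0) \<le> 1" by (rule floorlog_leI) auto
  moreover have "floorlog 2 (m + n) \<le> Suc (Suc (Suc (Suc (floorlog 2 m + floorlog 2 n))))" for m n
    using vsize_Num_add[of m n] by simp
  ultimately show "vsize (apply_atom a x) \<le> vsize x + (2 + (case a of Const v \<Rightarrow> vsize v | _ \<Rightarrow> 0))"
    by (induction a x rule: apply_atom.induct)
       (auto simp: floorlog_def[of 2 0] intro: le_trans[OF floorlog_mult_le] le_trans le_SucI)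
qed

section \<open>Closure under composition, pairing and branching\<close>

lemma polytime_atom: "polytime D (apply_atom a)"
proof -
  obtain c where "\<And>x. vsize (apply_atom a x) \<le> vsize x + c" by (rule vsize_apply_atom[of a]) (rule that)
  then have c: "vsize x + vsize (apply_atom a x) \<le> poly [:c, 2:] (vsize x)" for x
    by (simp add: mult_2 add.commute add.left_commute)
  show ?thesis
    by (rule polytimeI[where p = "Atom a"]) (use runs.atom c in blast)
qed

text \<open>The second program is polynomial in the intermediate value, whose size is at most the
  time of the first. Polynomials over \<open>nat\<close> are monotone, so
  \<open>pcompose q' q\<close> bounds the second run.\<close>

lemma polytime_comp:
  assumes "polytime E g" "polytime D f" "\<And>x. x \<in> D \<Longrightarrow> f x \<in> E"
  shows "polytime D (\<lambda>x. g (f x))"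
proof -
  obtain p q where f: "\<And>x. x \<in> D \<Longrightarrow> \<exists>t. runs p x (f x) t \<and> t \<le> poly q (vsize x)"
    by (rule polytimeE[OF assms(2)]) (rule that)
  obtain p' q' where g: "\<And>x. x \<in> E \<Longrightarrow> \<exists>t. runs p' x (g x) t \<and> t \<le> poly q' (vsize x)"
    by (rule polytimeE[OF assms(1)]) (rule that)
  show ?thesis
  proof (rule polytimeI[where p = "Seq p p'" and q = "q + pcompose q' q + 1"])
    fix x assume x: "x \<in> D"
    obtain s where s: "runs p x (f x) s" "s \<le> poly q (vsize x)" using f x by blast
    obtain t where t: "runs p' (f x) (g (f x)) t" "t \<le> poly q' (vsize (f x))"
      using g assms(3) x by blast
    have "vsize (f x) \<le> poly q (vsize x)" using s vsize_le_time le_trans by blast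
    from poly_nat_mono[OF this, of q'] t(2) have "t \<le> poly (pcompose q' q) (vsize x)"
      by (simp add: poly_pcompose)
    then show "\<exists>t. runs (Seq p p') x (g (f x)) t \<and> t \<le> poly (q + pcompose q' q + 1) (vsize x)"
      using runs.seq[OF s(1) t(1)] s(2) by (intro exI conjI) auto
  qed
qed

lemma polytime_cong:
  assumes "polytime D g" "\<And>x. x \<in> D \<Longrightarrow> f x = g x"
  shows "polytime D f"
  using assms unfolding polytime_def by simp

lemma polytime_apply: "polytime D f \<Longrightarrow> polytime D (\<lambda>x. apply_atom a (f x))"
  using polytime_comp[OF polytime_atom] by blast

lemma polytime_id: "polytime D (\<lambda>x. x)"
  by (rule polytime_cong[OF polytime_atom[of D Id]]) simp

lemma polytime_const: "polytime D (\<lambda>x. v)"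
  by (rule polytime_cong[OF polytime_atom[of D "Const v"]]) simp

lemma polytime_pair:
  assumes "polytime D f" "polytime D g"
  shows "polytime D (\<lambda>x. Pair (f x) (g x))"
proof -
  obtain p q where f: "\<And>x. x \<in> D \<Longrightarrow> \<exists>t. runs p x (f x) t \<and> t \<le> poly q (vsize x)"
    by (rule polytimeE[OF assms(1)]) (rule that)
  obtain p' q' where g: "\<And>x. x \<in> D \<Longrightarrow> \<exists>t. runs p' x (g x) t \<and> t \<le> poly q' (vsize x)"
    by (rule polytimeE[OF assms(2)]) (rule that)
  show ?thesis
  proof (rule polytimeI[where p = "Fork p p'" and q = "q + q' + 1"])
    fix x assume x: "x \<in> D"
    obtain s where s: "runs p x (f x) s" "s \<le> poly q (vsize x)" using f x by blast
    obtain t where t: "runs p' x (g x) t" "t \<le> poly q' (vsize x)" using g x by blast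
    show "\<exists>t. runs (Fork p p') x (Pair (f x) (g x)) t \<and> t \<le> poly (q + q' + 1) (vsize x)"
      using runs.fork[OF s(1) t(1)] s(2) t(2) by (intro exI conjI) auto
  qed
qed

definition truth :: "bool \<Rightarrow> val" where
  "truth b = (if b then Num 1 else Num 0)"

lemma polytime_If_val:
  assumes "polytime D c" "polytime D f" "polytime D g"
  shows "polytime D (\<lambda>x. if c x \<noteq> Num 0 then f x else g x)"
proof -
  obtain p0 q0 where c: "\<And>x. x \<in> D \<Longrightarrow> \<exists>t. runs p0 x (c x) t \<and> t \<le> poly q0 (vsize x)"
    by (rule polytimeE[OF assms(1)]) (rule that)
  obtain p q where f: "\<And>x. x \<in> D \<Longrightarrow> \<exists>t. runs p x (f x) t \<and> t \<le> poly q (vsize x)"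
    by (rule polytimeE[OF assms(2)]) (rule that)
  obtain p' q' where g: "\<And>x. x \<in> D \<Longrightarrow> \<exists>t. runs p' x (g x) t \<and> t \<le> poly q' (vsize x)"
    by (rule polytimeE[OF assms(3)]) (rule that)
  show ?thesis
  proof (rule polytimeI[where p = "prog.If p0 p p'" and q = "q0 + q + q' + 1"])
    fix x assume x: "x \<in> D"
    obtain r where r: "runs p0 x (c x) r" "r \<le> poly q0 (vsize x)" using c x by blast
    obtain s where s: "runs p x (f x) s" "s \<le> poly q (vsize x)" using f x by blast
    obtain t where t: "runs p' x (g x) t" "t \<le> poly q' (vsize x)" using g x by blast
    show "\<exists>t. runs (prog.If p0 p p') x (if c x \<noteq> Num 0 then f x else g x) t \<and>
        t \<le> poly (q0 + q + q' + 1) (vsize x)"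
    proof (cases "c x = Num 0")
      case True
      then show ?thesis using runs.if_false[of p0 x r, OF _ t(1)] r s t by (intro exI conjI) auto
    next
      case False
      then show ?thesis using runs.if_true[OF r(1) _ s(1)] r s t by (intro exI conjI) auto
    qed
  qed
qed

lemma truth_eq_0 [simp]: "truth b = Num 0 \<longleftrightarrow> \<not> b"
  by (simp add: truth_def)

lemma polytime_If:
  assumes "polytime D (\<lambda>x. truth (P x))" "polytime D f" "polytime D g"
  shows "polytime D (\<lambda>x. if P x then f x else g x)"
  using polytime_If_val[OF assms] by simp

lemma polytime_not:
  assumes "polytime D (\<lambda>x. truth (P x))"
  shows "polytime D (\<lambda>x. truth (\<not> P x))"
  by (rule polytime_cong[OF polytime_If[OF assms polytime_const[of _ "Num 0"] polytime_const[of _ "Num 1"]]])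
     (simp add: truth_def)

lemma polytime_conj:
  assumes "polytime D (\<lambda>x. truth (P x))" "polytime D (\<lambda>x. truth (Q x))"
  shows "polytime D (\<lambda>x. truth (P x \<and> Q x))"
  by (rule polytime_cong[OF polytime_If[OF assms(1) assms(2) polytime_const[of _ "Num 0"]]])
     (simp add: truth_def)

lemma polytime_disj:
  assumes "polytime D (\<lambda>x. truth (P x))" "polytime D (\<lambda>x. truth (Q x))"
  shows "polytime D (\<lambda>x. truth (P x \<or> Q x))"
  by (rule polytime_cong[OF polytime_If[OF assms(1) polytime_const[of _ "Num 1"] assms(2)]])
     (simp add: truth_def)

section \<open>Arithmetic and comparison of numbers\<close>

fun num :: "val \<Rightarrow> nat" where
  "num (Num n) = n"
| "num (Pair u v) = 0"

lemma polytime_num: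
  assumes "polytime D f"
  shows "polytime D (\<lambda>x. Num (num (f x)))"
proof (rule polytime_cong)
  show "polytime D (\<lambda>x. if apply_atom IsPair (f x) \<noteq> Num 0 then Num 0 else f x)"
    by (intro polytime_If_val polytime_apply polytime_const assms)
  show "Num (num (f x)) = (if apply_atom IsPair (f x) \<noteq> Num 0 then Num 0 else f x)" for x
    by (cases "f x") auto
qed

lemma polytime_add:
  assumes "polytime D (\<lambda>x. Num (f x))" "polytime D (\<lambda>x. Num (g x))"
  shows "polytime D (\<lambda>x. Num (f x + g x))"
  using polytime_apply[OF polytime_pair[OF assms], of Add] by simp

lemma polytime_mult:
  assumes "polytime D (\<lambda>x. Num (f x))" "polytime D (\<lambda>x. Num (g x))"
  shows "polytime D (\<lambda>x. Num (f x * g x))"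
  using polytime_apply[OF polytime_pair[OF assms], of Mul] by simp

lemma polytime_div:
  assumes "polytime D (\<lambda>x. Num (f x))" "polytime D (\<lambda>x. Num (g x))"
  shows "polytime D (\<lambda>x. Num (f x div g x))"
  using polytime_apply[OF polytime_pair[OF assms], of Div] by simp

text \<open>Truncated subtraction decides the order: \<open>g x - f x\<close> is nonzero exactly if
  \<open>f x < g x\<close>.\<close>

lemma polytime_less:
  assumes "polytime D (\<lambda>x. Num (f x))" "polytime D (\<lambda>x. Num (g x))"
  shows "polytime D (\<lambda>x. truth (f x < g x))"
  by (rule polytime_cong[OF polytime_If_val[OF polytime_apply[OF polytime_pair[OF assms(2,1)], of Sub]
      polytime_const[of _ "Num 1"] polytime_const[of _ "Num 0"]]]) (simp add: truth_def)

lemma polytime_le: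
  assumes "polytime D (\<lambda>x. Num (f x))" "polytime D (\<lambda>x. Num (g x))"
  shows "polytime D (\<lambda>x. truth (f x \<le> g x))"
  using polytime_not[OF polytime_less[OF assms(2,1)]] by (simp add: not_less)

lemma polytime_eq:
  assumes "polytime D (\<lambda>x. Num (f x))" "polytime D (\<lambda>x. Num (g x))"
  shows "polytime D (\<lambda>x. truth (f x = g x))"
  using polytime_conj[OF polytime_le[OF assms] polytime_le[OF assms(2,1)]]
  by (simp add: eq_iff)

subsection \<open>Lists\<close>

fun dec_list :: "val \<Rightarrow> val list" where
  "dec_list (Num n) = []"
| "dec_list (Pair u v) = u # dec_list v"

lemma dec_enc_list [simp]: "dec_list (enc_list vs) = vs"
  by (induction vs) auto

lemma vsize_in_dec_list: "h \<in> set (dec_list v) \<Longrightarrow> vsize h \<le> vsize v"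
  by (induction v) auto

lemma length_dec_list: "length (dec_list v) \<le> vsize v"
  by (induction v) auto

lemma vsize_enc_list_append: "vsize (enc_list (us @ vs)) \<le> vsize (enc_list us) + vsize (enc_list vs)"
  by (induction us) auto

lemma vsize_enc_dec_filter: "vsize (enc_list (filter P (dec_list v))) \<le> vsize v"
  by (induction v) (auto simp: floorlog_def)

text \<open>Programs have no variables, so a function of a loop element and the input becomes a
  function of a pair. Only the environment is restricted; the element in front of it is
  arbitrary.\<close>

definition with_env :: "val set \<Rightarrow> val set" where
  "with_env D = {Pair u x |u x. x \<in> D}"

lemma with_envI: "x \<in> D \<Longrightarrow> Pair u x \<in> with_env D"
  by (auto simp: with_env_def)

abbreviation vfst :: "val \<Rightarrow> val" where "vfst \<equiv> apply_atom Fst"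
abbreviation vsnd :: "val \<Rightarrow> val" where "vsnd \<equiv> apply_atom Snd"

lemma foldl_growth:
  assumes "\<And>h acc. h \<in> set hs \<Longrightarrow> vsize (g acc h) \<le> vsize acc + G"
  shows "vsize (foldl g acc hs) \<le> vsize acc + length hs * G"
  using assms
proof (induction hs arbitrary: acc)
  case (Cons h hs)
  have "vsize (foldl g (g acc h) hs) \<le> vsize (g acc h) + length hs * G"
    using Cons.prems by (intro Cons.IH) auto
  then show ?case using Cons.prems[of h acc] by simp
qed simp

text \<open>Additive growth of the accumulator keeps all intermediate values of polynomial size.\<close>

lemma polytime_foldl:
  fixes r :: "nat poly"
  assumes g: "polytime (with_env (with_env D)) (\<lambda>y. g (vfst y) (vfst (vsnd y)) (vsnd (vsnd y)))"
    and l: "polytime D l" and a: "polytime D a"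
    and growth: "\<And>x h acc. x \<in> D \<Longrightarrow> h \<in> set (dec_list (l x)) \<Longrightarrow>
      vsize (g h acc x) \<le> vsize acc + poly r (vsize x)"
  shows "polytime D (\<lambda>x. foldl (\<lambda>acc h. g h acc x) (a x) (dec_list (l x)))"
proof -
  \<comment> \<open>A loop state holds the remaining list, the accumulator and the environment. The
    body runs only on states with a nonempty remaining list, and these form
    \<open>E\<close>.\<close>
  define E where "E = {Pair (Pair h t) (Pair acc x) |h t acc x. x \<in> D}"
  define body where "body = (\<lambda>s. Pair (vsnd (vfst s))
    (Pair (g (vfst (vfst s)) (vfst (vsnd s)) (vsnd (vsnd s))) (vsnd (vsnd s))))"
  have "polytime E (\<lambda>s. (\<lambda>y. g (vfst y) (vfst (vsnd y)) (vsnd (vsnd y))) (Pair (vfst (vfst s)) (vsnd s)))"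
    by (rule polytime_comp[OF g])
       (auto simp: E_def with_env_def intro!: polytime_pair polytime_apply polytime_id)
  then have "polytime E body"
    unfolding body_def by (simp, intro polytime_pair polytime_apply polytime_id)
  then obtain pb qb where
    body: "\<And>s. s \<in> E \<Longrightarrow> \<exists>t. runs pb s (body s) t \<and> t \<le> poly qb (vsize s)"
    by (elim polytimeE) blast
  have "polytime UNIV (\<lambda>s. apply_atom IsPair (vfst s))"
    by (intro polytime_apply polytime_id)
  then obtain pc qc where
    test: "\<And>s. \<exists>t. runs pc s (apply_atom IsPair (vfst s)) t \<and> t \<le> poly qc (vsize s)"
    by (elim polytimeE) blast
  define T where "T = qb + qc + 1"
  \<comment> \<open>\<open>N\<close> bounds every state reached, since the accumulator grows by at
    most \<open>G\<close> per remaining element; hence each round costs at most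
    \<open>poly T N\<close>. The witness \<open>e\<close> is whatever number ends the list.\<close>
  have loop: "\<exists>e t. runs (While pc pb) (Pair l (Pair acc x))
      (Pair e (Pair (foldl (\<lambda>acc h. g h acc x) acc (dec_list l)) x)) t \<and>
      t \<le> (length (dec_list l) + 1) * poly T N"
    if "x \<in> D" "\<And>h acc. h \<in> set (dec_list l) \<Longrightarrow> vsize (g h acc x) \<le> vsize acc + G"
      "vsize l + vsize acc + length (dec_list l) * G + vsize x + 2 \<le> N" for x l acc G N
    using that(2,3)
  proof (induction l arbitrary: acc)
    case (Num n)
    let ?s = "Pair (Num n) (Pair acc x)"
    obtain t where t: "runs pc ?s (Num 0) t" "t \<le> poly qc (vsize ?s)"
      using test[of ?s] by auto
    have "poly qc (vsize ?s) \<le> poly qc N" using Num by (intro poly_nat_mono) simp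
    with t(2) runs.while_false[OF t(1), of pb] show ?case by (intro exI conjI) (auto simp: T_def)
  next
    case (Pair h l)
    let ?s = "val.Pair (val.Pair h l) (val.Pair acc x)"
    let ?s' = "val.Pair l (val.Pair (g h acc x) x)"
    obtain t0 where t0: "runs pc ?s (Num 1) t0" "t0 \<le> poly qc (vsize ?s)"
      using test[of ?s] by auto
    obtain t1 where t1: "runs pb ?s ?s' t1" "t1 \<le> poly qb (vsize ?s)"
      using body[of ?s] \<open>x \<in> D\<close> by (auto simp: E_def body_def)
    have s: "vsize ?s \<le> N" using Pair.prems(2) by simp
    have "vsize (g h acc x) \<le> vsize acc + G" using Pair.prems(1) by simp
    then have "vsize l + vsize (g h acc x) + length (dec_list l) * G + vsize x + 2 \<le> N"
      using Pair.prems(2) by simp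
    then obtain e t2 where t2: "runs (While pc pb) ?s'
        (val.Pair e (val.Pair (foldl (\<lambda>acc h. g h acc x) (g h acc x) (dec_list l)) x)) t2"
        "t2 \<le> (length (dec_list l) + 1) * poly T N"
      using Pair.IH(2)[OF Pair.prems(1)] by fastforce
    have "runs (While pc pb) ?s
        (val.Pair e (val.Pair (foldl (\<lambda>acc h. g h acc x) (g h acc x) (dec_list l)) x)) (t0 + t1 + t2 + 1)"
      by (rule runs.while_true[OF t0(1) _ t1(1) t2(1)]) simp
    moreover have "t0 + t1 + t2 + 1 \<le> (length (dec_list l) + 1 + 1) * poly T N"
      using t0(2) t1(2) t2(2) poly_nat_mono[OF s, of qc] poly_nat_mono[OF s, of qb] by (simp add: T_def)
    ultimately show ?case by auto
  qed
  have "polytime D (\<lambda>x. Pair (l x) (Pair (a x) x))"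
    by (intro polytime_pair l a polytime_id)
  then obtain pi qi where init:
    "\<And>x. x \<in> D \<Longrightarrow> \<exists>t. runs pi x (Pair (l x) (Pair (a x) x)) t \<and> t \<le> poly qi (vsize x)"
    by (elim polytimeE) blast
  obtain ql where ql: "\<And>x. x \<in> D \<Longrightarrow> vsize (l x) \<le> poly ql (vsize x)" by (rule polytime_vsize[OF l]) (rule that)
  obtain qa where qa: "\<And>x. x \<in> D \<Longrightarrow> vsize (a x) \<le> poly qa (vsize x)" by (rule polytime_vsize[OF a]) (rule that)
  \<comment> \<open>The summand \<open>[:2, 1:]\<close> accounts for the environment and the two
    pair constructors of a loop state.\<close>
  define M where "M = ql + qa + ql * r + [:2, 1:]"
  define R where "R = qi + (ql + 1) * pcompose T M + 1"
  define h where "h = (\<lambda>x. foldl (\<lambda>acc h. g h acc x) (a x) (dec_list (l x)))"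
  have run: "\<exists>e t. runs (Seq pi (While pc pb)) x (Pair e (Pair (h x) x)) t \<and> t \<le> poly R (vsize x)"
    if x: "x \<in> D" for x
  proof -
    obtain t0 where t0: "runs pi x (Pair (l x) (Pair (a x) x)) t0" "t0 \<le> poly qi (vsize x)"
      using init x by blast
    have len: "length (dec_list (l x)) \<le> poly ql (vsize x)"
      using length_dec_list ql[OF x] le_trans by blast
    have N: "vsize (l x) + vsize (a x) + length (dec_list (l x)) * poly r (vsize x) + vsize x + 2
        \<le> poly M (vsize x)"
      using add_mono[OF add_mono[OF ql[OF x] qa[OF x]] mult_le_mono1[OF len, of "poly r (vsize x)"]]
      by (simp add: M_def)
    obtain e t1 where t1: "runs (While pc pb) (Pair (l x) (Pair (a x) x)) (Pair e (Pair (h x) x)) t1"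
        "t1 \<le> (length (dec_list (l x)) + 1) * poly T (poly M (vsize x))"
      using loop[OF x growth[OF x] N] unfolding h_def by blast
    have "t1 \<le> (poly ql (vsize x) + 1) * poly T (poly M (vsize x))"
      using t1(2) mult_le_mono1[of "length (dec_list (l x)) + 1" "poly ql (vsize x) + 1"] len
      by (meson add_le_mono1 le_trans)
    then show ?thesis using runs.seq[OF t0(1) t1(1)] t0(2)
      by (intro exI conjI) (auto simp: R_def poly_pcompose)
  qed
  \<comment> \<open>The leftover end marker depends on the input, so it is turned into a function
    \<open>e\<close> before the projections discard it.\<close>
  have "\<forall>x. \<exists>e. x \<in> D \<longrightarrow>
      (\<exists>t. runs (Seq pi (While pc pb)) x (Pair e (Pair (h x) x)) t \<and> t \<le> poly R (vsize x))"
    using run by blast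
  then obtain e where e: "\<And>x. x \<in> D \<Longrightarrow>
      \<exists>t. runs (Seq pi (While pc pb)) x (Pair (e x) (Pair (h x) x)) t \<and> t \<le> poly R (vsize x)"
    by metis
  have "polytime D (\<lambda>x. Pair (e x) (Pair (h x) x))" by (rule polytimeI) (rule e)
  from polytime_apply[OF polytime_apply[OF this, of Snd], of Fst]
  show ?thesis by (simp add: h_def)
qed

text \<open>A list element is no larger than the list, so its image is bounded in terms of the
  environment alone, as the growth condition of \<open>polytime_foldl\<close> demands.\<close>

lemma polytime_with_env_vsize:
  assumes f: "polytime (with_env D) (\<lambda>y. f (vfst y) (vsnd y))" and l: "polytime D l"
  obtains q :: "nat poly" where "\<And>x h. x \<in> D \<Longrightarrow> h \<in> set (dec_list (l x)) \<Longrightarrow> vsize (f h x) \<le> poly q (vsize x)"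
proof -
  obtain qf where qf: "\<And>y. y \<in> with_env D \<Longrightarrow> vsize (f (vfst y) (vsnd y)) \<le> poly qf (vsize y)"
    using polytime_vsize[OF f] by blast
  obtain ql where ql: "\<And>x. x \<in> D \<Longrightarrow> vsize (l x) \<le> poly ql (vsize x)" by (rule polytime_vsize[OF l]) (rule that)
  show thesis
  proof
    fix x h assume x: "x \<in> D" and h: "h \<in> set (dec_list (l x))"
    have "vsize (f h x) \<le> poly qf (vsize (Pair h x))" using qf[OF with_envI[OF x, of h]] by simp
    also have "\<dots> \<le> poly qf (poly (ql + [:1, 1:]) (vsize x))"
      using vsize_in_dec_list[OF h] ql[OF x] by (intro poly_nat_mono) simp
    finally show "vsize (f h x) \<le> poly (pcompose qf (ql + [:1, 1:])) (vsize x)"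
      by (simp add: poly_pcompose)
  qed
qed

text \<open>The body of a fold sees element, accumulator and environment; this adapts a function
  that ignores the accumulator.\<close>

lemma polytime_with_env2:
  assumes "polytime (with_env D) (\<lambda>y. f (vfst y) (vsnd y))"
  shows "polytime (with_env (with_env D)) (\<lambda>y. f (vfst y) (vsnd (vsnd y)))"
proof -
  have "polytime (with_env (with_env D)) (\<lambda>y. Pair (vfst y) (vsnd (vsnd y)))"
    by (intro polytime_pair polytime_apply polytime_id)
  moreover have "Pair (vfst y) (vsnd (vsnd y)) \<in> with_env D" if "y \<in> with_env (with_env D)" for y
    using that by (auto simp: with_env_def)
  ultimately have "polytime (with_env (with_env D)) (\<lambda>y. (\<lambda>z. f (vfst z) (vsnd z)) (Pair (vfst y) (vsnd (vsnd y))))"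
    by (rule polytime_comp[OF assms])
  then show ?thesis by simp
qed

section \<open>Sums, bounded quantifiers and list operations as folds\<close>

lemma polytime_sum_list:
  assumes f: "polytime (with_env D) (\<lambda>y. Num (f (vfst y) (vsnd y)))" and l: "polytime D l"
  shows "polytime D (\<lambda>x. Num (\<Sum>h\<leftarrow>dec_list (l x). f h x))"
proof -
  obtain r where r: "\<And>x h. x \<in> D \<Longrightarrow> h \<in> set (dec_list (l x)) \<Longrightarrow> vsize (Num (f h x)) \<le> poly r (vsize x)"
    by (rule polytime_with_env_vsize[OF f l]) (rule that)
  \<comment> \<open>The growth condition ranges over all accumulators, including pairs, hence the
    total decoder \<open>num\<close>.\<close>
  have "vsize (Num (num acc + n)) \<le> vsize acc + vsize (Num n)" for acc n
    using vsize_Num_add[of "num acc" n] by (cases acc) auto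
  then have "polytime D (\<lambda>x. foldl (\<lambda>acc h. Num (num acc + f h x)) (Num 0) (dec_list (l x)))"
    by (intro polytime_foldl[where r = r] l polytime_const polytime_add polytime_num polytime_apply polytime_id
          polytime_with_env2[OF f]) (use r le_trans add_left_mono in blast)
  moreover have "foldl (\<lambda>acc h. Num (num acc + f h x)) (Num m) hs = Num (m + (\<Sum>h\<leftarrow>hs. f h x))" for x hs m
    by (induction hs arbitrary: m) auto
  ultimately show ?thesis by simp
qed

lemma polytime_length: "polytime D l \<Longrightarrow> polytime D (\<lambda>x. Num (length (dec_list (l x))))"
  using polytime_sum_list[of D "\<lambda>_ _. 1" l] polytime_const by (simp add: sum_list_triv)

text \<open>Existence is tested by counting the witnesses with
  \<open>polytime_sum_list\<close>.\<close>

lemma polytime_bex: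
  assumes P: "polytime (with_env D) (\<lambda>y. truth (P (vfst y) (vsnd y)))" and l: "polytime D l"
  shows "polytime D (\<lambda>x. truth (\<exists>h\<in>set (dec_list (l x)). P h x))"
proof -
  have "polytime D (\<lambda>x. Num (\<Sum>h\<leftarrow>dec_list (l x). if P h x then 1 else 0))"
    by (intro polytime_sum_list[OF _ l])
       (use P in \<open>simp add: truth_def if_distrib[of Num] cong: if_cong\<close>)
  from polytime_less[OF polytime_const[of _ "Num 0"] this]
  have "polytime D (\<lambda>x. truth (0 < (\<Sum>h\<leftarrow>dec_list (l x). if P h x then 1 else 0 :: nat)))" .
  moreover have "0 < (\<Sum>h\<leftarrow>hs. if Q h then 1 else 0 :: nat) \<longleftrightarrow> (\<exists>h\<in>set hs. Q h)" for Q and hs :: "val list"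
    by (induction hs) auto
  ultimately show ?thesis by simp
qed

lemma polytime_ball:
  assumes P: "polytime (with_env D) (\<lambda>y. truth (P (vfst y) (vsnd y)))" and l: "polytime D l"
  shows "polytime D (\<lambda>x. truth (\<forall>h\<in>set (dec_list (l x)). P h x))"
  using polytime_not[OF polytime_bex[OF polytime_not[OF P] l]] by simp

lemma foldl_Pair: "foldl (\<lambda>acc h. if P h then Pair (f h) acc else acc) (enc_list vs) hs =
    enc_list (rev (map f (filter P hs)) @ vs)"
  by (induction hs arbitrary: vs) (auto simp flip: enc_list.simps)

text \<open>Consing onto the accumulator reverses the list. The lemmas on append and map below
  restore the order by a second pass.\<close>

lemma polytime_rev_map_filter_append:
  assumes P: "polytime (with_env D) (\<lambda>y. truth (P (vfst y) (vsnd y)))"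
    and f: "polytime (with_env D) (\<lambda>y. f (vfst y) (vsnd y))"
    and l: "polytime D l" and a: "polytime D (\<lambda>x. enc_list (a x))"
  shows "polytime D (\<lambda>x. enc_list (rev (map (\<lambda>h. f h x) (filter (\<lambda>h. P h x) (dec_list (l x)))) @ a x))"
proof -
  obtain r where r: "\<And>x h. x \<in> D \<Longrightarrow> h \<in> set (dec_list (l x)) \<Longrightarrow> vsize (f h x) \<le> poly r (vsize x)"
    by (rule polytime_with_env_vsize[OF f l]) (rule that)
  have "polytime D (\<lambda>x. foldl (\<lambda>acc h. if P h x then Pair (f h x) acc else acc) (enc_list (a x)) (dec_list (l x)))"
    by (intro polytime_foldl[where r = "r + 1"] l a polytime_If polytime_pair polytime_apply polytime_id
          polytime_with_env2[OF f] polytime_with_env2[where f = "\<lambda>h x. truth (P h x)", OF P])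
       (use r in \<open>auto simp: le_SucI\<close>)
  then show ?thesis by (simp add: foldl_Pair)
qed

lemma polytime_append:
  assumes a: "polytime D (\<lambda>x. enc_list (a x))" and b: "polytime D (\<lambda>x. enc_list (b x))"
  shows "polytime D (\<lambda>x. enc_list (a x @ b x))"
proof -
  have "polytime D (\<lambda>x. enc_list (rev (map (\<lambda>h. h) (filter (\<lambda>h. True) (dec_list (enc_list (a x))))) @ []))"
    by (intro polytime_rev_map_filter_append a polytime_const polytime_apply polytime_id)
  then have "polytime D (\<lambda>x. enc_list (rev (a x)))" by simp
  then have "polytime D (\<lambda>x. enc_list (rev (map (\<lambda>h. h) (filter (\<lambda>h. True) (dec_list (enc_list (rev (a x)))))) @ b x))"
    by (intro polytime_rev_map_filter_append b polytime_const polytime_apply polytime_id)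
  then show ?thesis by simp
qed

lemma polytime_map_filter:
  assumes P: "polytime (with_env D) (\<lambda>y. truth (P (vfst y) (vsnd y)))"
    and f: "polytime (with_env D) (\<lambda>y. f (vfst y) (vsnd y))"
    and l: "polytime D l"
  shows "polytime D (\<lambda>x. enc_list (map (\<lambda>h. f h x) (filter (\<lambda>h. P h x) (dec_list (l x)))))"
proof -
  have "polytime D (\<lambda>x. enc_list (rev (map (\<lambda>h. f h x) (filter (\<lambda>h. P h x) (dec_list (l x)))) @ []))"
    by (intro polytime_rev_map_filter_append[OF P f l] polytime_const)
  note * = this
  have "polytime D (\<lambda>x. enc_list (rev (map (\<lambda>h. h) (filter (\<lambda>h. True) (dec_list (enc_list
     (rev (map (\<lambda>h. f h x) (filter (\<lambda>h. P h x) (dec_list (l x)))) @ []))))) @ []))"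
    by (rule polytime_rev_map_filter_append) (rule * | intro polytime_const polytime_apply polytime_id)+
  then show ?thesis by (simp add: rev_map)
qed

lemma polytime_map:
  assumes "polytime (with_env D) (\<lambda>y. f (vfst y) (vsnd y))" and "polytime D l"
  shows "polytime D (\<lambda>x. enc_list (map (\<lambda>h. f h x) (dec_list (l x))))"
  using polytime_map_filter[OF polytime_const[of _ "truth True"] assms] by simp

lemma polytime_filter:
  assumes "polytime (with_env D) (\<lambda>y. truth (P (vfst y) (vsnd y)))" and "polytime D l"
  shows "polytime D (\<lambda>x. enc_list (filter (\<lambda>h. P h x) (dec_list (l x))))"
  using polytime_map_filter[OF assms(1) polytime_apply[OF polytime_id, of _ Fst] assms(2)] by simp

lemmas polytime_intros = polytime_const polytime_id polytime_apply polytime_pair polytime_If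
  polytime_not polytime_conj polytime_disj polytime_num polytime_add polytime_mult polytime_div
  polytime_less polytime_le polytime_eq polytime_sum_list polytime_length polytime_bex polytime_ball
  polytime_append polytime_map polytime_filter

section \<open>Local optima of the squared weight\<close>

text \<open>The disjunct \<open>a = s\<close> matters for the empty set, which is disjoint from
  itself: with it, every member of \<open>A\<close> is its own neighbour, so a swap never keeps a
  second copy of it.\<close>

definition nbh :: "nat set \<Rightarrow> nat set set \<Rightarrow> nat set set" where
  "nbh s A = {a \<in> A. a \<inter> s \<noteq> {} \<or> a = s}"

definition candidates :: "nat set set \<Rightarrow> (nat set \<Rightarrow> nat) \<Rightarrow> nat \<Rightarrow> nat set set \<Rightarrow> nat \<Rightarrow> nat set set" where
  "candidates S w C A \<theta> = {s \<in> S. \<theta> \<le> w s \<and> w s < 2 * \<theta> \<and> (\<Sum>a\<in>nbh s A. w a) \<le> C * w s}"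

section \<open>Counting conflicts between two packings\<close>

lemma sum_UN_le_nat:
  assumes "finite X" "\<And>x. x \<in> X \<Longrightarrow> finite (g x)"
  shows "sum f (\<Union>x\<in>X. g x) \<le> (\<Sum>x\<in>X. sum f (g x) :: nat)"
  using assms
proof (induction X rule: finite_induct)
  case (insert x X)
  have "sum f (g x \<union> (\<Union>x\<in>X. g x)) \<le> sum f (g x) + sum f (\<Union>x\<in>X. g x)"
    using insert by (subst sum_Un_nat) auto
  with insert show ?case by simp
qed simp

text \<open>Each member of \<open>B\<close> that meets \<open>a\<close> can be charged to a common
  element, and disjointness of \<open>B\<close> makes the charge injective. An empty
  \<open>a\<close> conflicts only with itself, which is where \<open>1 \<le> k\<close>
  enters.\<close>

lemma card_conflicts_le:
  assumes "B \<in> packings S" "finite a" "card a \<le> k" "1 \<le> k"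
  shows "card {b \<in> B. a \<inter> b \<noteq> {} \<or> a = b} \<le> k"
proof (cases "a = {}")
  case True
  then have "{b \<in> B. a \<inter> b \<noteq> {} \<or> a = b} \<subseteq> {{}}" by auto
  then have "card {b \<in> B. a \<inter> b \<noteq> {} \<or> a = b} \<le> card {{} :: nat set}" by (intro card_mono) auto
  with assms show ?thesis by simp
next
  case False
  define f where "f b = (SOME u. u \<in> a \<inter> b)" for b
  have f: "f b \<in> a \<inter> b" if "b \<in> {b \<in> B. a \<inter> b \<noteq> {} \<or> a = b}" for b
  proof -
    have "\<exists>u. u \<in> a \<inter> b" using that False by auto
    then show ?thesis unfolding f_def by (rule someI_ex)
  qed
  have "inj_on f {b \<in> B. a \<inter> b \<noteq> {} \<or> a = b}"
  proof (rule inj_onI)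
    fix b c assume *: "b \<in> {b \<in> B. a \<inter> b \<noteq> {} \<or> a = b}" "c \<in> {b \<in> B. a \<inter> b \<noteq> {} \<or> a = b}" "f b = f c"
    then have "f b \<in> b" "f b \<in> c" using f[of b] f[of c] by simp_all
    then have "\<not> disjnt b c" by (auto simp: disjnt_def)
    moreover have "pairwise disjnt B" using assms(1) by (simp add: packings_def)
    ultimately show "b = c" using *(1,2) by (auto dest: pairwiseD)
  qed
  then have "card {b \<in> B. a \<inter> b \<noteq> {} \<or> a = b} \<le> card a"
    using f assms(2) by (intro card_inj_on_le[of f]) auto
  with assms show ?thesis by simp
qed

text \<open>Double counting: after exchanging the sums, each \<open>a\<close> is counted once per
  member of \<open>B\<close> in conflict with it.\<close>

lemma sum_nbh_le:
  fixes w :: "nat set \<Rightarrow> nat"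
  assumes "B \<in> packings S" "finite B" "finite A" "\<And>a. a \<in> A \<Longrightarrow> finite a \<and> card a \<le> k" "1 \<le> k"
  shows "(\<Sum>b\<in>B. \<Sum>a\<in>nbh b A. w a) \<le> k * (\<Sum>a\<in>A. w a)"
proof -
  have "(\<Sum>b\<in>B. \<Sum>a\<in>nbh b A. w a) = (\<Sum>a\<in>A. \<Sum>b\<in>{b \<in> B. a \<inter> b \<noteq> {} \<or> a = b}. w a)"
    unfolding nbh_def using assms by (intro sum.swap_restrict)
  also have "\<dots> \<le> (\<Sum>a\<in>A. k * w a)"
    using card_conflicts_le[OF assms(1)] assms by (intro sum_mono) (simp add: mult_le_mono1)
  finally show ?thesis by (simp add: sum_distrib_left)
qed

text \<open>This is where squaring matters: an element of \<open>A\<close> much lighter than \<open>\<theta>\<close> contributes little to the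
  squared weight of a neighbourhood whose weight is at most \<open>C * w x\<close>. Hence only boundedly many
  dyadic weight classes, in terms of \<open>C\<close> alone, are relevant to each element of \<open>A\<close>.\<close>

lemma class_weight_le:
  fixes w :: "nat set \<Rightarrow> nat"
  assumes fin: "finite A" "finite X" and C: "1 \<le> C" and \<theta>: "0 < \<theta>"
    and X: "X \<subseteq> candidates S w C A \<theta>"
    and opt: "(\<Sum>x\<in>X. (w x)\<^sup>2) \<le> (\<Sum>a\<in>(\<Union>x\<in>X. nbh x A). (w a)\<^sup>2)"
  shows "\<theta> * card X \<le> 4 * C * (\<Sum>a\<in>{a \<in> A. \<theta> < 2 * C * w a \<and> w a < 2 * C * \<theta>}. w a)"
proof -
  let ?N = "\<Union>x\<in>X. nbh x A"
  let ?small = "{a \<in> ?N. 2 * C * w a \<le> \<theta>}" and ?big = "{a \<in> ?N. \<theta> < 2 * C * w a}"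
  let ?A = "{a \<in> A. \<theta> < 2 * C * w a \<and> w a < 2 * C * \<theta>}"
  have finN: "finite ?N" and fnb: "finite (nbh x A)" for x using fin by (auto simp: nbh_def)
  have x: "\<theta> \<le> w x" "w x < 2 * \<theta>" "(\<Sum>a\<in>nbh x A. w a) \<le> C * w x" if "x \<in> X" for x
    using X that by (auto simp: candidates_def)
  \<comment> \<open>For a small \<open>a\<close>, one factor of its square is traded for
    \<open>\<theta>\<close>. Then \<open>\<theta> \<le> w x\<close> and the weight bound on
    neighbourhoods of candidates leave at most half of the squared weight of
    \<open>X\<close>.\<close>
  have "2 * C * (\<Sum>a\<in>?small. (w a)\<^sup>2) \<le> (\<Sum>a\<in>?small. \<theta> * w a)"
    unfolding sum_distrib_left power2_eq_square mult.assoc[symmetric]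
    by (intro sum_mono mult_le_mono1) auto
  also have "\<dots> \<le> (\<Sum>a\<in>?N. \<theta> * w a)" using finN by (intro sum_mono2) auto
  also have "\<dots> \<le> (\<Sum>x\<in>X. \<Sum>a\<in>nbh x A. \<theta> * w a)" using fin fnb by (intro sum_UN_le_nat)
  also have "\<dots> \<le> (\<Sum>x\<in>X. w x * (C * w x))"
    using x by (intro sum_mono, unfold sum_distrib_left[symmetric], intro mult_le_mono) auto
  also have "\<dots> = C * (\<Sum>x\<in>X. (w x)\<^sup>2)"
    by (simp add: sum_distrib_left power2_eq_square mult_ac)
  finally have "2 * C * (\<Sum>a\<in>?small. (w a)\<^sup>2) \<le> C * (\<Sum>x\<in>X. (w x)\<^sup>2)" .
  then have small: "2 * (\<Sum>a\<in>?small. (w a)\<^sup>2) \<le> (\<Sum>x\<in>X. (w x)\<^sup>2)" using C by simp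
  have "(\<Sum>a\<in>?N. (w a)\<^sup>2) = (\<Sum>a\<in>?small \<union> ?big. (w a)\<^sup>2)"
    by (rule sum.cong) auto
  also have "\<dots> = (\<Sum>a\<in>?small. (w a)\<^sup>2) + (\<Sum>a\<in>?big. (w a)\<^sup>2)"
    by (intro sum.union_disjoint finite_subset[OF _ finN]) auto
  \<comment> \<open>Since the small neighbours cover at most half of the left side,
    \<open>opt\<close> forces the big ones to cover the other half.\<close>
  finally have "(\<Sum>x\<in>X. (w x)\<^sup>2) \<le> 2 * (\<Sum>a\<in>?big. (w a)\<^sup>2)" using opt small by simp
  also have "(\<Sum>a\<in>?big. (w a)\<^sup>2) \<le> (\<Sum>a\<in>?A. (w a)\<^sup>2)"
  proof (intro sum_mono2)
    show "?big \<subseteq> ?A"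
    proof
      fix a assume a: "a \<in> ?big"
      then obtain y where y: "y \<in> X" "a \<in> nbh y A" by auto
      have "w a \<le> (\<Sum>a\<in>nbh y A. w a)" using member_le_sum[OF y(2), of w] fnb by auto
      also have "\<dots> \<le> C * w y" using x y by auto
      also have "\<dots> < 2 * C * \<theta>" using C x(2)[OF y(1)] by simp
      finally show "a \<in> ?A" using a by (auto simp: nbh_def)
    qed
  qed (use fin in auto)
  \<comment> \<open>Here the upper limit on weights in \<open>?A\<close> turns squares back into
    weights; the extra factor \<open>\<theta>\<close> cancels at the end.\<close>
  also have "\<dots> \<le> (\<Sum>a\<in>?A. 2 * C * \<theta> * w a)"
    unfolding power2_eq_square by (intro sum_mono mult_le_mono1) auto
  finally have *: "(\<Sum>x\<in>X. (w x)\<^sup>2) \<le> \<theta> * (4 * C * (\<Sum>a\<in>?A. w a))"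
    by (simp add: sum_distrib_left mult_ac)
  have "\<theta> * (\<theta> * card X) = (\<Sum>x\<in>X. \<theta> * \<theta>)" by simp
  also have "\<dots> \<le> (\<Sum>x\<in>X. (w x)\<^sup>2)"
    unfolding power2_eq_square using x by (intro sum_mono mult_le_mono)
  finally have "\<theta> * (\<theta> * card X) \<le> \<theta> * (4 * C * (\<Sum>a\<in>?A. w a))" using * by (rule le_trans)
  with \<theta> show ?thesis by (simp only: nat_mult_le_cancel1)
qed

text \<open>All thresholds close to \<open>v\<close> lie within a factor
  \<open>4 * C\<^sup>2\<close> of each other, and \<open>\<theta> j\<close> has \<open>j\<close>
  binary digits, so the indices fit into a short interval above the least one.\<close>

lemma card_dyadic_le:
  fixes J :: "nat set" and \<theta> :: "nat \<Rightarrow> nat"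
  assumes "1 \<le> C" and J: "\<And>j. j \<in> J \<Longrightarrow> 2 ^ (j - 1) \<le> \<theta> j \<and> \<theta> j < 2 ^ j"
  shows "card {j \<in> J. \<theta> j < 2 * C * v \<and> v < 2 * C * \<theta> j} \<le> 8 * C\<^sup>2" (is "card ?K \<le> _")
proof (cases "?K = {}")
  case True
  then show ?thesis by (simp only: card.empty)
next
  case False
  define i where "i = (LEAST j. j \<in> ?K)"
  have i: "i \<in> ?K" and least: "\<And>j. j \<in> ?K \<Longrightarrow> i \<le> j"
    using False LeastI[of "\<lambda>j. j \<in> ?K"] Least_le[of "\<lambda>j. j \<in> ?K"] unfolding i_def by blast+
  have "j \<le> i + 4 * C\<^sup>2" if j: "j \<in> ?K" for j
  proof -
    have "2 ^ (j - 1) \<le> \<theta> j" using J j by auto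
    also have "\<dots> < 2 * C * v" using j by auto
    also have "\<dots> \<le> 2 * C * (2 * C * \<theta> i)" using i by (intro mult_le_mono2) auto
    also have "\<dots> = 4 * C\<^sup>2 * \<theta> i" by (simp add: power2_eq_square)
    \<comment> \<open>The crude estimate \<open>n < 2 ^ n\<close> replaces a logarithm: only
      independence of \<open>k\<close> matters for the bound.\<close>
    also have "\<dots> \<le> 2 ^ (4 * C\<^sup>2) * 2 ^ i"
      using J[of i] i less_exp[of "4 * C\<^sup>2"] by (intro mult_le_mono less_imp_le) auto
    finally have "(2::nat) ^ (j - 1) < 2 ^ (4 * C\<^sup>2 + i)" by (simp add: power_add)
    then show ?thesis by (simp add: power_strict_increasing_iff)
  qed
  with least have "?K \<subseteq> {i..i + 4 * C\<^sup>2}" by auto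
  then have "card ?K \<le> card {i..i + 4 * C\<^sup>2}" by (intro card_mono) auto
  also have "\<dots> \<le> 8 * C\<^sup>2" using assms(1) by (simp add: Suc_le_eq)
  finally show ?thesis .
qed

text \<open>What a failed swap leaves behind: the rejected output \<open>X\<close> of the solver
  certifies that \<open>A\<close> is locally optimal at threshold \<open>\<theta>\<close>.\<close>

definition blocking ::
    "nat set set \<Rightarrow> (nat set \<Rightarrow> nat) \<Rightarrow> nat \<Rightarrow> real \<Rightarrow> nat set set \<Rightarrow> nat \<Rightarrow> nat set set \<Rightarrow> bool" where
  "blocking S w C r A \<theta> X \<longleftrightarrow> X \<subseteq> candidates S w C A \<theta> \<and>
     (\<forall>B\<in>packings (candidates S w C A \<theta>). real (card B) \<le> r * real (card X)) \<and>
     (\<Sum>x\<in>X. (w x)\<^sup>2) \<le> (\<Sum>a\<in>(\<Union>x\<in>X. nbh x A). (w a)\<^sup>2)"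

text \<open>The first term pays for sets with too heavy a neighbourhood, the second for all dyadic
  classes together. Its constant is 2 for the width of a class, times \<open>4 * C\<close> from
  \<open>class_weight_le\<close>, times \<open>8 * C\<^sup>2\<close> from
  \<open>card_dyadic_le\<close>.\<close>

lemma local_optimum_bound:
  fixes w :: "nat set \<Rightarrow> nat" and r :: real
  assumes S: "finite S" "\<And>s. s \<in> S \<Longrightarrow> finite s \<and> card s \<le> k" and k: "1 \<le> k" and C: "1 \<le> C"
    and A: "A \<in> packings S" and B: "B \<in> packings S" and r: "0 \<le> r"
    and stuck: "\<And>s. s \<in> S \<Longrightarrow> \<exists>X. blocking S w C r A (w s) X"
  shows "real (\<Sum>b\<in>B. w b) \<le> (real k / real C + 64 * real C ^ 3 * r) * real (\<Sum>a\<in>A. w a)"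
proof -
  define X where "X \<theta> = (SOME X. blocking S w C r A \<theta> X)" for \<theta>
  have X: "blocking S w C r A \<theta> (X \<theta>)" if "\<theta> \<in> w ` S" for \<theta>
    unfolding X_def using stuck that by (intro someI_ex[of "blocking S w C r A \<theta>"]) auto
  have sub: "A \<subseteq> S" "B \<subseteq> S" using A B by (auto simp: packings_def)
  have fin: "finite A" "finite B" using S(1) sub finite_subset by auto
  \<comment> \<open>Sets of rounded weight 0 are left out of \<open>G\<close>: they cost nothing in
    the complement, and positivity gives each member of \<open>G\<close> a dyadic class.\<close>
  define G where "G = {b \<in> B. 0 < w b \<and> (\<Sum>a\<in>nbh b A. w a) \<le> C * w b}"
  have finG: "finite G" using fin by (simp add: G_def)
  have "C * (\<Sum>b\<in>B - G. w b) \<le> (\<Sum>b\<in>B - G. \<Sum>a\<in>nbh b A. w a)"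
    unfolding sum_distrib_left by (intro sum_mono) (auto simp: G_def)
  also have "\<dots> \<le> (\<Sum>b\<in>B. \<Sum>a\<in>nbh b A. w a)" using fin by (intro sum_mono2) auto
  also have "\<dots> \<le> k * (\<Sum>a\<in>A. w a)" using sum_nbh_le[OF B fin(2,1) _ k] S sub by auto
  finally have "real C * real (\<Sum>b\<in>B - G. w b) \<le> real k * real (\<Sum>a\<in>A. w a)"
    unfolding of_nat_mult[symmetric] of_nat_le_iff .
  then have bad: "real (\<Sum>b\<in>B - G. w b) \<le> real k / real C * real (\<Sum>a\<in>A. w a)"
    using C by (simp add: field_simps)
  define J where "J = (\<lambda>b. floorlog 2 (w b)) ` G"
  define cl where "cl j = {b \<in> G. floorlog 2 (w b) = j}" for j
  \<comment> \<open>The least weight of the class is taken instead of a power of two, because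
    \<open>stuck\<close> speaks only of thresholds that are weights of sets in
    \<open>S\<close>.\<close>
  define \<theta> where "\<theta> j = Min (w ` cl j)" for j
  define near where "near j = {a \<in> A. \<theta> j < 2 * C * w a \<and> w a < 2 * C * \<theta> j}" for j
  have finJ: "finite J" using finG by (simp add: J_def)
  have \<theta>: "\<theta> j \<in> w ` cl j" "\<And>b. b \<in> cl j \<Longrightarrow> \<theta> j \<le> w b" if "j \<in> J" for j
  proof -
    have "finite (cl j)" "cl j \<noteq> {}" using that finG by (auto simp: J_def cl_def)
    then show "\<theta> j \<in> w ` cl j" "\<And>b. b \<in> cl j \<Longrightarrow> \<theta> j \<le> w b"
      unfolding \<theta>_def by (auto intro: Min_in)
  qed
  have dyadic: "2 ^ (j - 1) \<le> w b \<and> w b < 2 ^ j" if "b \<in> cl j" for b j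
    using that floorlog_bounds[of "w b" 2] by (auto simp: cl_def G_def)
  have \<theta>_dyadic: "2 ^ (j - 1) \<le> \<theta> j \<and> \<theta> j < 2 ^ j" if "j \<in> J" for j
    using \<theta>(1)[OF that] dyadic by auto
  have J_pos: "0 < j" if "j \<in> J" for j
    using that by (auto simp: J_def G_def floorlog_eq_zero_iff intro!: gr0I)
  have cls: "real (\<Sum>b\<in>cl j. w b) \<le> 8 * C * r * real (\<Sum>a\<in>near j. w a)" if j: "j \<in> J" for j
  proof -
    have pos: "0 < \<theta> j" using \<theta>_dyadic[OF j] by (auto intro: gr0I)
    have inS: "\<theta> j \<in> w ` S" using \<theta>(1)[OF j] sub by (auto simp: cl_def G_def)
    note X' = X[OF inS, unfolded blocking_def]
    have dbl: "w b < 2 * \<theta> j" if "b \<in> cl j" for b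
    proof -
      have "w b < 2 ^ (Suc (j - 1))" using dyadic[OF that] J_pos[OF j] by simp
      also have "\<dots> \<le> 2 * \<theta> j" using \<theta>_dyadic[OF j] by simp
      finally show ?thesis .
    qed
    have "cl j \<in> packings (candidates S w C A (\<theta> j))"
      using B sub dbl \<theta>(2)[OF j] unfolding packings_def candidates_def
      by (auto simp: cl_def G_def intro: pairwise_subset)
    then have card: "real (card (cl j)) \<le> r * real (card (X (\<theta> j)))" using X' by blast
    have "finite (X (\<theta> j))"
      using X' S(1) by (auto simp: candidates_def intro: finite_subset)
    then have near: "\<theta> j * card (X (\<theta> j)) \<le> 4 * C * (\<Sum>a\<in>near j. w a)"
      unfolding near_def using X' fin C pos by (intro class_weight_le[where S = S]) auto
    \<comment> \<open>Weights in one class differ by less than a factor 2, so cardinality, which is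
      what the unweighted solver approximates, can stand in for weight.\<close>
    have "(\<Sum>b\<in>cl j. w b) \<le> (\<Sum>b\<in>cl j. 2 * \<theta> j)" using dbl by (intro sum_mono less_imp_le)
    then have "real (\<Sum>b\<in>cl j. w b) \<le> real (2 * \<theta> j * card (cl j))"
      unfolding of_nat_le_iff by (simp add: mult_ac)
    then have "real (\<Sum>b\<in>cl j. w b) \<le> 2 * real (\<theta> j) * real (card (cl j))" by simp
    also have "\<dots> \<le> 2 * real (\<theta> j) * (r * real (card (X (\<theta> j))))"
      using card by (intro mult_left_mono) auto
    also have "\<dots> = 2 * r * real (\<theta> j * card (X (\<theta> j)))" by simp
    also have "\<dots> \<le> 2 * r * real (4 * C * (\<Sum>a\<in>near j. w a))"
      using near r by (intro mult_left_mono) (simp_all only: of_nat_le_iff)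
    finally show ?thesis by (simp add: mult_ac)
  qed
  have "(\<Sum>j\<in>J. \<Sum>a\<in>near j. w a) =
      (\<Sum>a\<in>A. \<Sum>j\<in>{j \<in> J. \<theta> j < 2 * C * w a \<and> w a < 2 * C * \<theta> j}. w a)"
    unfolding near_def using finJ fin by (intro sum.swap_restrict)
  also have "\<dots> \<le> (\<Sum>a\<in>A. 8 * C\<^sup>2 * w a)"
    using card_dyadic_le[OF C \<theta>_dyadic] by (intro sum_mono) (simp add: mult_le_mono1)
  finally have overlap: "(\<Sum>j\<in>J. \<Sum>a\<in>near j. w a) \<le> 8 * C\<^sup>2 * (\<Sum>a\<in>A. w a)"
    by (simp add: sum_distrib_left)
  have "(\<Sum>b\<in>G. w b) = (\<Sum>j\<in>J. \<Sum>b\<in>cl j. w b)"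
    unfolding J_def cl_def using finG by (rule sum.image_gen)
  then have "real (\<Sum>b\<in>G. w b) = (\<Sum>j\<in>J. real (\<Sum>b\<in>cl j. w b))" by simp
  also have "\<dots> \<le> (\<Sum>j\<in>J. 8 * C * r * real (\<Sum>a\<in>near j. w a))"
    using cls by (intro sum_mono)
  also have "\<dots> = 8 * C * r * real (\<Sum>j\<in>J. \<Sum>a\<in>near j. w a)"
    by (simp add: sum_distrib_left)
  also have "\<dots> \<le> 8 * C * r * real (8 * C\<^sup>2 * (\<Sum>a\<in>A. w a))"
    using overlap r by (intro mult_left_mono) (simp_all only: of_nat_le_iff, simp)
  also have "\<dots> = 64 * real C ^ 3 * r * real (\<Sum>a\<in>A. w a)"
    by (simp add: power2_eq_square power3_eq_cube)
  finally have good: "real (\<Sum>b\<in>G. w b) \<le> 64 * real C ^ 3 * r * real (\<Sum>a\<in>A. w a)" .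
  have "(\<Sum>b\<in>B. w b) = (\<Sum>b\<in>B - G. w b) + (\<Sum>b\<in>G. w b)"
    using fin by (intro sum.subset_diff) (auto simp: G_def)
  then show ?thesis using bad good by (simp add: distrib_right)
qed

section \<open>The local search step\<close>

subsection \<open>Running time\<close>

definition dec_set :: "val \<Rightarrow> nat set" where
  "dec_set v = num ` set (dec_list v)"

lemma polytime_comp2:
  assumes "polytime UNIV (\<lambda>x. f (vfst x) (vsnd x))" "polytime D a" "polytime D b"
  shows "polytime D (\<lambda>x. f (a x) (b x))"
  using polytime_comp[OF assms(1) polytime_pair[OF assms(2,3)]] by simp

definition clash :: "val \<Rightarrow> val \<Rightarrow> bool" where
  "clash a e \<longleftrightarrow> dec_set (vfst a) \<inter> dec_set (vfst e) \<noteq> {} \<or> dec_set (vfst a) = dec_set (vfst e)"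

text \<open>The atoms work on numbers only, so equality of sets is expressed as mutual inclusion
  with bounded quantifiers.\<close>

lemma polytime_dec_set_eq:
  assumes "polytime D f" "polytime D g"
  shows "polytime D (\<lambda>x. truth (dec_set (f x) = dec_set (g x)))"
proof (rule polytime_comp2[OF _ assms, where f = "\<lambda>u v. truth (dec_set u = dec_set v)"])
  have "dec_set u = dec_set v \<longleftrightarrow>
      (\<forall>a\<in>set (dec_list u). \<exists>b\<in>set (dec_list v). num a = num b) \<and>
      (\<forall>b\<in>set (dec_list v). \<exists>a\<in>set (dec_list u). num b = num a)" for u v
    unfolding dec_set_def set_eq_subset by (auto simp: image_subset_iff image_iff)
  then show "polytime UNIV (\<lambda>x. truth (dec_set (vfst x) = dec_set (vsnd x)))"
    by (simp only:) (intro polytime_intros)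
qed

lemma polytime_dec_set_meets:
  assumes "polytime D f" "polytime D g"
  shows "polytime D (\<lambda>x. truth (dec_set (f x) \<inter> dec_set (g x) \<noteq> {}))"
proof (rule polytime_comp2[OF _ assms, where f = "\<lambda>u v. truth (dec_set u \<inter> dec_set v \<noteq> {})"])
  have "dec_set u \<inter> dec_set v \<noteq> {} \<longleftrightarrow>
      (\<exists>a\<in>set (dec_list u). \<exists>b\<in>set (dec_list v). num a = num b)" for u v
    by (auto simp: dec_set_def image_iff set_eq_iff)
  then show "polytime UNIV (\<lambda>x. truth (dec_set (vfst x) \<inter> dec_set (vsnd x) \<noteq> {}))"
    by (simp only:) (intro polytime_intros)
qed

lemma polytime_clash:
  assumes "polytime D f" "polytime D g"
  shows "polytime D (\<lambda>x. truth (clash (f x) (g x)))"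
  unfolding clash_def
  by (intro polytime_disj polytime_dec_set_meets polytime_dec_set_eq polytime_apply assms)

lemma polytime_If_nat:
  assumes "polytime D (\<lambda>x. truth (P x))" "polytime D (\<lambda>x. Num (f x))" "polytime D (\<lambda>x. Num (g x))"
  shows "polytime D (\<lambda>x. Num (if P x then f x else g x))"
  using polytime_If[OF assms] by (simp add: if_distrib cong: if_cong)

lemma polytime_enc_dec: "polytime D f \<Longrightarrow> polytime D (\<lambda>x. enc_list (dec_list (f x)))"
  using polytime_map[of D "\<lambda>h _. h" f] polytime_apply[OF polytime_id] by simp

section \<open>The operations of one local step on encoded lists\<close>

definition wt :: "val \<Rightarrow> nat" where
  "wt e = num (vsnd e)"

definition candidate_list :: "nat \<Rightarrow> nat \<Rightarrow> val \<Rightarrow> val \<Rightarrow> val" where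
  "candidate_list C \<theta> A L = enc_list (filter (\<lambda>e. \<theta> \<le> wt e \<and> wt e < 2 * \<theta> \<and>
     (\<Sum>a\<leftarrow>dec_list A. if clash a e then wt a else 0) \<le> C * wt e) (dec_list L))"

text \<open>\<open>Pair (Num 1) (Num 1)\<close> is the encoding of the rational weight 1.\<close>

definition unit_instance :: "val \<Rightarrow> val" where
  "unit_instance c = enc_list (map (\<lambda>e. Pair (vfst e) (Pair (Num 1) (Num 1))) (dec_list c))"

text \<open>The solver returns bare sets; looking them up in \<open>L\<close> restores the weights.
  Since the result is a sublist of \<open>L\<close>, its size is controlled for every
  \<open>Y\<close>.\<close>

definition select :: "val \<Rightarrow> val \<Rightarrow> val" where
  "select Y L = enc_list (filter (\<lambda>e. \<exists>y\<in>set (dec_list Y). dec_set y = dec_set (vfst e)) (dec_list L))"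

definition improves :: "val \<Rightarrow> val \<Rightarrow> bool" where
  "improves X A \<longleftrightarrow> (\<Sum>a\<leftarrow>dec_list A. if \<exists>e\<in>set (dec_list X). clash a e then wt a * wt a else 0)
     < (\<Sum>e\<leftarrow>dec_list X. wt e * wt e)"

definition swap_in :: "val \<Rightarrow> val \<Rightarrow> val" where
  "swap_in X A = enc_list (dec_list X @ filter (\<lambda>a. \<not> (\<exists>e\<in>set (dec_list X). clash a e)) (dec_list A))"

definition local_step :: "nat \<Rightarrow> (val \<Rightarrow> val) \<Rightarrow> val \<Rightarrow> val \<Rightarrow> val \<Rightarrow> val" where
  "local_step C solver h A L =
    (let X = select (solver (unit_instance (candidate_list C (wt h) A L))) L
     in if improves X A then swap_in X A else A)"

lemma polytime_candidate_list:
  "polytime D (\<lambda>y. candidate_list C (wt (vfst y)) (vfst (vsnd y)) (vsnd (vsnd y)))"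
  unfolding candidate_list_def wt_def
  by (intro polytime_intros polytime_clash polytime_If_nat)

lemma polytime_unit_instance: "polytime D f \<Longrightarrow> polytime D (\<lambda>x. unit_instance (f x))"
  unfolding unit_instance_def by (intro polytime_intros)

lemma polytime_select: "polytime D f \<Longrightarrow> polytime D g \<Longrightarrow> polytime D (\<lambda>x. select (f x) (g x))"
  by (rule polytime_comp2) (auto simp: select_def intro!: polytime_intros polytime_dec_set_eq)

lemma polytime_improves:
  assumes "polytime D f" "polytime D g"
  shows "polytime D (\<lambda>x. truth (improves (f x) (g x)))"
  by (rule polytime_comp2[OF _ assms, where f = "\<lambda>u v. truth (improves u v)"], unfold improves_def wt_def)
    (intro polytime_intros polytime_clash polytime_If_nat)

lemma polytime_swap_in: "polytime D f \<Longrightarrow> polytime D g \<Longrightarrow> polytime D (\<lambda>x. swap_in (f x) (g x))"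
  by (rule polytime_comp2[where f = swap_in], unfold swap_in_def)
    (intro polytime_intros polytime_clash polytime_enc_dec | assumption)+

text \<open>Whatever \<open>sol\<close> returns, the result is built from a sublist of
  \<open>L\<close> and a sublist of \<open>A\<close>. This is the additive growth that
  \<open>polytime_foldl\<close> needs.\<close>

lemma vsize_local_step: "vsize (local_step C sol h A L) \<le> vsize A + vsize L"
proof -
  have "vsize (swap_in (select Y L) A) \<le> vsize L + vsize A" for Y
    unfolding swap_in_def
    by (rule le_trans[OF vsize_enc_list_append], intro add_mono)
       (simp_all add: select_def vsize_enc_dec_filter del: dec_enc_list, simp add: vsize_enc_dec_filter)
  then show ?thesis by (simp add: local_step_def Let_def add.commute)
qed

text \<open>Loop variable and accumulator range over all values, so the solver has to receive a
  legal instance even if \<open>A\<close> encodes no packing; the second assumption expresses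
  this.\<close>

lemma polytime_local_step:
  assumes sol: "polytime E sol" and V: "\<And>h A L. L \<in> V \<Longrightarrow> unit_instance (candidate_list C (wt h) A L) \<in> E"
  shows "polytime (with_env (with_env V)) (\<lambda>y. local_step C sol (vfst y) (vfst (vsnd y)) (vsnd (vsnd y)))"
proof -
  have "polytime (with_env (with_env V))
      (\<lambda>y. sol (unit_instance (candidate_list C (wt (vfst y)) (vfst (vsnd y)) (vsnd (vsnd y)))))"
    by (rule polytime_comp[OF sol]) (use V in \<open>auto simp: with_env_def intro!: polytime_unit_instance polytime_candidate_list\<close>)
  then show ?thesis
    unfolding local_step_def Let_def
    by (intro polytime_If polytime_improves polytime_swap_in polytime_select polytime_apply polytime_id)
qed

text \<open>The arguments are the loop variable, the accumulator and the environment.\<close>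

definition stepper :: "val set \<Rightarrow> (val \<Rightarrow> val \<Rightarrow> val \<Rightarrow> val) \<Rightarrow> bool" where
  "stepper V F \<longleftrightarrow> polytime (with_env (with_env V)) (\<lambda>y. F (vfst y) (vfst (vsnd y)) (vsnd (vsnd y))) \<and>
     (\<exists>r :: nat poly. \<forall>x\<in>V. \<forall>h acc. vsize (F h acc x) \<le> vsize acc + poly r (vsize x))"

text \<open>With the extra element, three nested loops around a sweep over \<open>n\<close> entries run
  \<open>(n + 1)\<^sup>3\<close> sweeps, which exceeds the bound \<open>n\<^sup>3\<close> on the potential. So some sweep changes nothing.\<close>

definition for_each :: "(val \<Rightarrow> val \<Rightarrow> val \<Rightarrow> val) \<Rightarrow> val \<Rightarrow> val \<Rightarrow> val \<Rightarrow> val" where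
  "for_each F h acc x = foldl (\<lambda>a e. F e a x) acc (Num 0 # dec_list x)"

text \<open>This permits nesting loops to a fixed depth: one loop multiplies the growth by at most
  \<open>vsize x + 1\<close>, still a polynomial in the environment.\<close>

lemma stepper_for_each:
  assumes "stepper V F"
  shows "stepper V (for_each F)"
  unfolding stepper_def
proof
  obtain r :: "nat poly" where r: "\<And>x h acc. x \<in> V \<Longrightarrow> vsize (F h acc x) \<le> vsize acc + poly r (vsize x)"
    using assms unfolding stepper_def by blast
  let ?E = "with_env (with_env V)"
  have F: "polytime ?E (\<lambda>y. F (vfst y) (vfst (vsnd y)) (vsnd (vsnd y)))"
    using assms unfolding stepper_def by blast
  \<comment> \<open>The inner body sees its own element and accumulator in front of those of the
    outer loop; this rewiring drops the outer two.\<close>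
  have "polytime (with_env (with_env ?E)) (\<lambda>y. Pair (vfst y) (Pair (vfst (vsnd y)) (vsnd (vsnd (vsnd (vsnd y))))))"
    by (intro polytime_intros)
  moreover have "Pair (vfst y) (Pair (vfst (vsnd y)) (vsnd (vsnd (vsnd (vsnd y))))) \<in> ?E"
    if "y \<in> with_env (with_env ?E)" for y
    using that by (auto simp: with_env_def)
  ultimately have "polytime (with_env (with_env ?E)) (\<lambda>y. (\<lambda>z. F (vfst z) (vfst (vsnd z)) (vsnd (vsnd z)))
      (Pair (vfst y) (Pair (vfst (vsnd y)) (vsnd (vsnd (vsnd (vsnd y)))))))"
    by (rule polytime_comp[OF F])
  then have F': "polytime (with_env (with_env ?E))
      (\<lambda>y. F (vfst y) (vfst (vsnd y)) (vsnd (vsnd (vsnd (vsnd y)))))" by simp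
  have "polytime ?E (\<lambda>y. foldl (\<lambda>a e. F e a (vsnd (vsnd y))) (vfst (vsnd y)) (dec_list (Pair (Num 0) (vsnd (vsnd y)))))"
  proof (rule polytime_foldl[where g = "\<lambda>e a y. F e a (vsnd (vsnd y))" and r = r, OF F'])
    fix y h acc assume "y \<in> ?E"
    then obtain u v x where y: "y = Pair u (Pair v x)" "x \<in> V" by (auto simp: with_env_def)
    have "poly r (vsize x) \<le> poly r (vsize y)" using y by (intro poly_nat_mono) simp
    then show "vsize (F h acc (vsnd (vsnd y))) \<le> vsize acc + poly r (vsize y)"
      using r[of x h acc] y by simp
  qed (intro polytime_intros)+
  then show "polytime ?E (\<lambda>y. for_each F (vfst y) (vfst (vsnd y)) (vsnd (vsnd y)))"
    by (simp add: for_each_def)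
  show "\<exists>r :: nat poly. \<forall>x\<in>V. \<forall>h acc. vsize (for_each F h acc x) \<le> vsize acc + poly r (vsize x)"
  proof (intro exI ballI allI)
    fix x h acc assume x: "x \<in> V"
    have "vsize (for_each F h acc x) \<le> vsize acc + length (Num 0 # dec_list x) * poly r (vsize x)"
      unfolding for_each_def by (rule foldl_growth) (rule r[OF x])
    also have "\<dots> \<le> vsize acc + (vsize x + 1) * poly r (vsize x)"
      using length_dec_list by (intro add_mono mult_le_mono) auto
    finally show "vsize (for_each F h acc x) \<le> vsize acc + poly ([:1, 1:] * r) (vsize x)"
      by (simp add: algebra_simps)
  qed
qed

text \<open>A loop whose body ignores the loop variable merely iterates, which is how the outer
  loops serve as counters.\<close>

lemma for_each_funpow:
  assumes "\<And>e a. F e a x = (f ^^ m) a"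
  shows "for_each F h acc x = (f ^^ (m * Suc (length (dec_list x)))) acc"
proof -
  have "foldl (\<lambda>a e. (f ^^ m) a) acc hs = (f ^^ (m * length hs)) acc" for hs :: "val list"
  proof (induction hs arbitrary: acc)
    case (Cons e hs)
    have "m * length (e # hs) = m * length hs + m" by simp
    then show ?case by (simp only: foldl.simps Cons.IH funpow_add o_apply)
  qed simp
  from this[of "Num 0 # dec_list x"] show ?thesis by (simp add: for_each_def assms)
qed

text \<open>The innermost loop sweeps over the thresholds and the outer three repeat the sweep. The
  first \<open>Num 0\<close> is a dummy loop variable, the second the empty packing.\<close>

definition local_search :: "nat \<Rightarrow> (val \<Rightarrow> val) \<Rightarrow> val \<Rightarrow> val" where
  "local_search C sol L = for_each (for_each (for_each (for_each (local_step C sol)))) (Num 0) (Num 0) L"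

lemma local_search_funpow:
  "local_search C sol L =
    ((\<lambda>A. for_each (local_step C sol) (Num 0) A L) ^^ (Suc (length (dec_list L)) ^ 3)) (Num 0)"
proof -
  have "for_each (local_step C sol) e a L = ((\<lambda>A. for_each (local_step C sol) (Num 0) A L) ^^ 1) a" for e a
    by (simp add: for_each_def)
  note for_each_funpow[where F = "for_each (local_step C sol)", OF this]
  note for_each_funpow[where F = "for_each (for_each (local_step C sol))", OF this]
  note for_each_funpow[where F = "for_each (for_each (for_each (local_step C sol)))", OF this]
  from this[of "Num 0" "Num 0"] show ?thesis
    by (simp only: local_search_def power3_eq_cube mult.assoc mult_1)
qed

lemma polytime_local_search:
  assumes "polytime E sol" "\<And>h A L. L \<in> V \<Longrightarrow> unit_instance (candidate_list C (wt h) A L) \<in> E"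
  shows "polytime V (local_search C sol)"
proof -
  have "stepper V (local_step C sol)"
    unfolding stepper_def
    by (intro conjI polytime_local_step[OF assms] exI[of _ "[:0, 1:]"]) (use vsize_local_step in auto)
  then have "stepper V (for_each (for_each (for_each (for_each (local_step C sol)))))"
    by (intro stepper_for_each)
  then have F: "polytime (with_env (with_env V)) (\<lambda>y. for_each (for_each (for_each (for_each (local_step C sol))))
      (vfst y) (vfst (vsnd y)) (vsnd (vsnd y)))"
    by (simp add: stepper_def)
  have "polytime V (\<lambda>x. Pair (Num 0) (Pair (Num 0) x))" by (intro polytime_intros)
  then have "polytime V (\<lambda>x. (\<lambda>y. for_each (for_each (for_each (for_each (local_step C sol))))
      (vfst y) (vfst (vsnd y)) (vsnd (vsnd y))) (Pair (Num 0) (Pair (Num 0) x)))"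
    by (rule polytime_comp[OF F]) (simp add: with_env_def)
  then show ?thesis by (simp add: local_search_def[abs_def])
qed

subsection \<open>Correctness\<close>

definition entry :: "(nat set \<Rightarrow> nat) \<Rightarrow> nat set \<Rightarrow> val" where
  "entry w s = Pair (enc_set s) (Num (w s))"

lemma dec_set_enc_set [simp]: "finite s \<Longrightarrow> dec_set (enc_set s) = s"
  by (simp add: dec_set_def enc_set_def image_image)

lemma wt_entry [simp]: "wt (entry w s) = w s"
  by (simp add: wt_def entry_def)

lemma vfst_entry [simp]: "vfst (entry w s) = enc_set s"
  by (simp add: entry_def)

lemma clash_entry:
  "finite a \<Longrightarrow> finite s \<Longrightarrow> clash (entry w a) (entry w s) \<longleftrightarrow> a \<inter> s \<noteq> {} \<or> a = s"
  by (simp add: clash_def)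

lemma sum_list_if_distinct:
  "distinct xs \<Longrightarrow> (\<Sum>x\<leftarrow>xs. if P x then f x else 0) = (\<Sum>x\<in>{x \<in> set xs. P x}. f x)"
  by (simp add: sum_list_distinct_conv_sum_set sum.inter_filter)

definition enc_entries :: "(nat set \<Rightarrow> nat) \<Rightarrow> nat set list \<Rightarrow> val" where
  "enc_entries w ss = enc_list (map (entry w) ss)"

lemma dec_enc_entries [simp]: "dec_list (enc_entries w ss) = map (entry w) ss"
  by (simp add: enc_entries_def)

lemma candidate_list_enc:
  assumes "distinct as" "\<And>a. a \<in> set as \<Longrightarrow> finite a" "\<And>s. s \<in> set ss \<Longrightarrow> finite s"
  shows "candidate_list C \<theta> (enc_entries w as) (enc_entries w ss) =
    enc_entries w (filter (\<lambda>s. s \<in> candidates (set ss) w C (set as) \<theta>) ss)"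
proof -
  have "(\<Sum>a\<leftarrow>as. if clash (entry w a) (entry w s) then w a else 0) = (\<Sum>a\<in>nbh s (set as). w a)"
    if "s \<in> set ss" for s
    using assms that unfolding sum_list_if_distinct[OF assms(1)] nbh_def
    by (intro sum.cong) (auto simp: clash_entry)
  then show ?thesis
    unfolding candidate_list_def enc_entries_def
    by (auto simp: filter_map comp_def candidates_def cong: if_cong intro!: arg_cong[of _ _ "\<lambda>x. enc_list (map (entry w) x)"] filter_cong)
qed

lemma unit_instance_enc:
  assumes "distinct cs"
  shows "encodes_instance (unit_instance (enc_entries w cs)) (set cs, \<lambda>_. 1)"
  unfolding encodes_instance_def using assms
  by (auto simp: unit_instance_def enc_rat_def rat_one_code comp_def intro!: exI[of _ cs])

lemma select_enc:
  assumes "\<And>y. y \<in> set ys \<Longrightarrow> finite y" "\<And>s. s \<in> set ss \<Longrightarrow> finite s"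
  shows "select (enc_list (map enc_set ys)) (enc_entries w ss) = enc_entries w (filter (\<lambda>s. s \<in> set ys) ss)"
  using assms unfolding select_def enc_entries_def
  by (auto simp: filter_map comp_def intro!: arg_cong[of _ _ "\<lambda>x. enc_list (map (entry w) x)"] filter_cong)

lemma clash_any_enc:
  assumes "\<And>x. x \<in> set xs \<Longrightarrow> finite x" "a \<in> A" "finite a"
  shows "(\<exists>e\<in>set (dec_list (enc_entries w xs)). clash (entry w a) e) \<longleftrightarrow> a \<in> (\<Union>x\<in>set xs. nbh x A)"
  using assms by (auto simp: clash_entry nbh_def)

lemma improves_enc:
  assumes "distinct xs" "distinct as" "\<And>x. x \<in> set xs \<Longrightarrow> finite x" "\<And>a. a \<in> set as \<Longrightarrow> finite a"
  shows "improves (enc_entries w xs) (enc_entries w as) \<longleftrightarrow>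
    (\<Sum>a\<in>(\<Union>x\<in>set xs. nbh x (set as)). (w a)\<^sup>2) < (\<Sum>x\<in>set xs. (w x)\<^sup>2)"
proof -
  have "(\<Sum>a\<leftarrow>dec_list (enc_entries w as).
        if \<exists>e\<in>set (dec_list (enc_entries w xs)). clash a e then wt a * wt a else 0) =
      (\<Sum>a\<leftarrow>as. if a \<in> (\<Union>x\<in>set xs. nbh x (set as)) then w a * w a else 0)"
    unfolding dec_enc_entries[of w as] map_map comp_def wt_entry
    using assms clash_any_enc[of xs _ "set as" w] by (intro arg_cong[of _ _ sum_list] map_cong) auto
  also have "\<dots> = (\<Sum>a\<in>(\<Union>x\<in>set xs. nbh x (set as)). (w a)\<^sup>2)"
    unfolding sum_list_if_distinct[OF assms(2)] power2_eq_square
    by (rule sum.cong) (auto simp: nbh_def)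
  finally show ?thesis
    using assms(1) by (simp add: improves_def comp_def sum_list_distinct_conv_sum_set power2_eq_square)
qed

lemma swap_in_enc:
  assumes "\<And>x. x \<in> set xs \<Longrightarrow> finite x" "\<And>a. a \<in> set as \<Longrightarrow> finite a"
  shows "swap_in (enc_entries w xs) (enc_entries w as) =
    enc_entries w (xs @ filter (\<lambda>a. a \<notin> (\<Union>x\<in>set xs. nbh x (set as))) as)"
proof -
  have "filter (\<lambda>a. \<not> (\<exists>e\<in>set (dec_list (enc_entries w xs)). clash a e)) (map (entry w) as) =
      map (entry w) (filter (\<lambda>a. a \<notin> (\<Union>x\<in>set xs. nbh x (set as))) as)"
    unfolding filter_map comp_def
    using assms clash_any_enc[of xs _ "set as" w] by (intro arg_cong[of _ _ "map (entry w)"] filter_cong) auto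
  then show ?thesis
    unfolding swap_in_def dec_enc_entries[of w as] by (simp add: enc_entries_def)
qed

lemma packings_swap:
  assumes "X \<in> packings S" "A \<in> packings S"
  shows "X \<union> (A - (\<Union>x\<in>X. nbh x A)) \<in> packings S"
  using assms unfolding packings_def pairwise_def nbh_def disjnt_def by blast

section \<open>The squared weight as a potential\<close>

definition potential :: "val \<Rightarrow> nat" where
  "potential v = (\<Sum>e\<leftarrow>dec_list v. (wt e)\<^sup>2)"

definition encodes_packing :: "nat set set \<Rightarrow> (nat set \<Rightarrow> nat) \<Rightarrow> val \<Rightarrow> nat set list \<Rightarrow> bool" where
  "encodes_packing S w v as \<longleftrightarrow> distinct as \<and> set as \<in> packings S \<and> v = enc_entries w as"

text \<open>The ratio is multiplied out and unit weights become cardinalities. \<open>sol\<close> is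
  a total function, constrained only on legal inputs.\<close>

definition approx_solver :: "nat \<Rightarrow> real \<Rightarrow> (val \<Rightarrow> val) \<Rightarrow> bool" where
  "approx_solver k r sol \<longleftrightarrow> (\<forall>x S. (S, \<lambda>_. 1) \<in> unweighted_instances k \<longrightarrow> encodes_instance x (S, \<lambda>_. 1) \<longrightarrow>
     (\<exists>A. encodes_collection (sol x) A \<and> A \<in> packings S \<and> (\<forall>B\<in>packings S. real (card B) \<le> r * real (card A))))"

lemma potential_enc: "distinct as \<Longrightarrow> potential (enc_entries w as) = (\<Sum>a\<in>set as. (w a)\<^sup>2)"
  by (simp add: potential_def comp_def sum_list_distinct_conv_sum_set)

text \<open>If the swap is rejected, the output of the solver is the blocking set. Otherwise the
  squared weight gained on \<open>X\<close> exceeds what is lost on its neighbours.\<close>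

lemma local_step_correct:
  assumes sol: "approx_solver k r sol"
    and ss: "distinct ss" "\<forall>s\<in>set ss. finite s \<and> card s \<le> k"
    and v: "encodes_packing (set ss) w v as"
  shows "(local_step C sol h v (enc_entries w ss) = v \<and> (\<exists>X. blocking (set ss) w C r (set as) (wt h) X)) \<or>
    (\<exists>bs. encodes_packing (set ss) w (local_step C sol h v (enc_entries w ss)) bs \<and>
       potential v < potential (local_step C sol h v (enc_entries w ss)))"
proof -
  let ?S = "set ss" and ?A = "set as"
  have as: "distinct as" "?A \<in> packings ?S" "v = enc_entries w as" "?A \<subseteq> ?S"
    using v by (auto simp: encodes_packing_def packings_def)
  have fin: "finite a" if "a \<in> ?A" for a using as(4) ss(2) that by auto
  define cs where "cs = filter (\<lambda>s. s \<in> candidates ?S w C ?A (wt h)) ss"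
  have cs: "set cs = candidates ?S w C ?A (wt h)" "distinct cs"
    using ss by (auto simp: cs_def candidates_def)
  have cand: "candidate_list C (wt h) v (enc_entries w ss) = enc_entries w cs"
    unfolding as(3) cs_def using as ss fin by (intro candidate_list_enc) auto
  have "(set cs, \<lambda>_. 1) \<in> unweighted_instances k"
    using ss(2) by (auto simp: unweighted_instances_def weighted_instances_def cs candidates_def)
  then obtain X where X: "encodes_collection (sol (unit_instance (enc_entries w cs))) X"
      "X \<in> packings (set cs)" "\<forall>B\<in>packings (set cs). real (card B) \<le> r * real (card X)"
    using sol unit_instance_enc[OF cs(2), of w] unfolding approx_solver_def by blast
  then obtain ys where ys: "set ys = X" "sol (unit_instance (enc_entries w cs)) = enc_list (map enc_set ys)"
    by (auto simp: encodes_collection_def)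
  have X_sub: "X \<subseteq> candidates ?S w C ?A (wt h)" "X \<subseteq> ?S"
    using X(2) cs by (auto simp: packings_def candidates_def)
  \<comment> \<open>\<open>xs\<close> lists \<open>X\<close> in the order of \<open>ss\<close>, the
    order in which \<open>select\<close> returns it.\<close>
  define xs where "xs = filter (\<lambda>s. s \<in> X) ss"
  have xs: "distinct xs" "set xs = X" using ss X_sub by (auto simp: xs_def)
  have fin_xs: "finite x" if "x \<in> set xs" for x using xs X_sub ss(2) that by auto
  have sel: "select (sol (unit_instance (candidate_list C (wt h) v (enc_entries w ss)))) (enc_entries w ss)
      = enc_entries w xs"
    unfolding cand ys(2) xs_def ys(1)[symmetric] using ys X_sub ss by (intro select_enc) auto
  let ?N = "\<Union>x\<in>X. nbh x ?A"
  define bs where "bs = xs @ filter (\<lambda>a. a \<notin> ?N) as"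
  show ?thesis
  proof (cases "improves (enc_entries w xs) v")
    case False
    then have "(\<Sum>x\<in>X. (w x)\<^sup>2) \<le> (\<Sum>a\<in>?N. (w a)\<^sup>2)"
      using improves_enc[OF xs(1) as(1) fin_xs fin] by (simp add: as(3) xs(2) not_less)
    then have "blocking ?S w C r ?A (wt h) X"
      unfolding blocking_def using X(3) X_sub(1) cs(1) by auto
    then show ?thesis using False by (intro disjI1 conjI exI[of _ X]) (simp add: local_step_def sel)
  next
    case True
    then have gain: "(\<Sum>a\<in>?N. (w a)\<^sup>2) < (\<Sum>x\<in>X. (w x)\<^sup>2)"
      using improves_enc[OF xs(1) as(1) fin_xs fin] by (simp add: as(3) xs(2))
    have "swap_in (enc_entries w xs) (enc_entries w as) = enc_entries w bs"
      unfolding bs_def xs(2)[symmetric] using fin_xs fin by (rule swap_in_enc)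
    then have step: "local_step C sol h v (enc_entries w ss) = enc_entries w bs"
      using True unfolding local_step_def sel Let_def by (simp add: as(3))
    \<comment> \<open>Members of \<open>X\<close> already in \<open>A\<close> are removed as their
      own neighbours, so \<open>bs\<close> has no repetitions and the sum over it splits.\<close>
    have self: "x \<in> nbh x ?A" if "x \<in> ?A" for x using that by (simp add: nbh_def)
    have bs: "distinct bs" "set bs = X \<union> (?A - ?N)" "X \<inter> (?A - ?N) = {}"
      using xs as(1) self by (auto simp: bs_def)
    have "X \<in> packings ?S" using X(2) X_sub by (auto simp: packings_def)
    then have pack: "set bs \<in> packings ?S" using packings_swap as(2) bs(2) by simp
    have "?N \<subseteq> ?A" by (auto simp: nbh_def)
    then have "(\<Sum>a\<in>?A. (w a)\<^sup>2) = (\<Sum>a\<in>?A - ?N. (w a)\<^sup>2) + (\<Sum>a\<in>?N. (w a)\<^sup>2)"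
      by (intro sum.subset_diff) auto
    also have "\<dots> < (\<Sum>a\<in>?A - ?N. (w a)\<^sup>2) + (\<Sum>x\<in>X. (w x)\<^sup>2)" using gain by simp
    also have "\<dots> = (\<Sum>a\<in>set bs. (w a)\<^sup>2)"
      unfolding bs(2) using bs(3) xs(2) by (subst sum.union_disjoint) auto
    finally show ?thesis
      unfolding step using pack bs(1)
      by (intro disjI2 exI[of _ bs]) (simp add: encodes_packing_def potential_enc as(1,3))
  qed
qed

text \<open>If no step of the sweep changes the packing, all blocking sets refer to the same
  packing. Once a step changes it, later steps can only keep or raise the potential.\<close>

lemma sweep_correct:
  fixes C :: nat and hs :: "val list"
  assumes sol: "approx_solver k r sol"
    and ss: "distinct ss" "\<forall>s\<in>set ss. finite s \<and> card s \<le> k"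
    and v: "encodes_packing (set ss) w v as"
  defines "v' \<equiv> foldl (\<lambda>a h. local_step C sol h a (enc_entries w ss)) v hs"
  shows "(v' = v \<and> (\<forall>h\<in>set hs. \<exists>X. blocking (set ss) w C r (set as) (wt h) X)) \<or>
    (\<exists>bs. encodes_packing (set ss) w v' bs \<and> potential v < potential v')"
  using v unfolding v'_def
proof (induction hs arbitrary: v as)
  case (Cons h hs)
  show ?case
    using local_step_correct[OF sol ss Cons.prems, where h = h and C = C]
  proof (elim disjE conjE)
    assume "local_step C sol h v (enc_entries w ss) = v" "\<exists>X. blocking (set ss) w C r (set as) (wt h) X"
    then show ?thesis using Cons.IH[OF Cons.prems] by auto
  next
    assume "\<exists>bs. encodes_packing (set ss) w (local_step C sol h v (enc_entries w ss)) bs \<and>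
      potential v < potential (local_step C sol h v (enc_entries w ss))"
    then obtain bs where "encodes_packing (set ss) w (local_step C sol h v (enc_entries w ss)) bs"
      "potential v < potential (local_step C sol h v (enc_entries w ss))" by blast
    then show ?thesis using Cons.IH[of "local_step C sol h v (enc_entries w ss)" bs] by fastforce
  qed
qed auto

text \<open>Until a fixed point is reached each round gains at least 1, so more rounds than the
  bound on the potential reach one, and further rounds stay there.\<close>

lemma funpow_fixpoint:
  fixes pot :: "'a \<Rightarrow> nat"
  assumes step: "\<And>v. P v \<Longrightarrow> (f v = v \<and> Q v) \<or> (P (f v) \<and> pot v < pot (f v))"
    and bound: "\<And>v. P v \<Longrightarrow> pot v \<le> M" and "P v" "M < m"
  shows "P ((f ^^ m) v) \<and> Q ((f ^^ m) v)"
proof -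
  have "P ((f ^^ n) v) \<and> ((f ((f ^^ n) v) = (f ^^ n) v \<and> Q ((f ^^ n) v)) \<or> n \<le> pot ((f ^^ n) v))" for n
  proof (induction n)
    case (Suc n)
    then show ?case using step[of "(f ^^ n) v"] step[of "f ((f ^^ n) v)"] by fastforce
  qed (use assms in auto)
  from this[of m] show ?thesis using bound[of "(f ^^ m) v"] \<open>M < m\<close> by auto
qed

text \<open>This is the purpose of rounding: at most \<open>n\<close> sets of integer weight at most
  \<open>n\<close> leave room for only polynomially many improvements.\<close>

lemma potential_le:
  assumes "encodes_packing (set ss) w v as" "\<forall>s\<in>set ss. w s \<le> length ss"
  shows "potential v \<le> length ss ^ 3"
proof -
  have as: "distinct as" "set as \<subseteq> set ss" "v = enc_entries w as"
    using assms(1) by (auto simp: encodes_packing_def packings_def)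
  have "(\<Sum>a\<in>set as. (w a)\<^sup>2) \<le> (\<Sum>a\<in>set as. (length ss)\<^sup>2)"
    using assms(2) as(2) by (intro sum_mono power_mono) auto
  also have "\<dots> \<le> length ss * (length ss)\<^sup>2"
    using card_mono[OF _ as(2)] card_length[of ss] by simp
  finally show ?thesis using as by (simp add: potential_enc power3_eq_cube power2_eq_square)
qed

lemma local_search_correct:
  assumes sol: "approx_solver k r sol"
    and ss: "distinct ss" "\<forall>s\<in>set ss. finite s \<and> card s \<le> k"
    and w: "\<forall>s\<in>set ss. w s \<le> length ss"
  obtains as where "encodes_packing (set ss) w (local_search C sol (enc_entries w ss)) as"
    and "\<And>s. s \<in> set ss \<Longrightarrow> \<exists>X. blocking (set ss) w C r (set as) (w s) X"
proof -
  define f where "f A = for_each (local_step C sol) (Num 0) A (enc_entries w ss)" for A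
  define Q where "Q v \<longleftrightarrow> (\<exists>as. encodes_packing (set ss) w v as \<and>
    (\<forall>s\<in>set ss. \<exists>X. blocking (set ss) w C r (set as) (w s) X))" for v
  have step: "(f v = v \<and> Q v) \<or> ((\<exists>as. encodes_packing (set ss) w (f v) as) \<and> potential v < potential (f v))"
    if "\<exists>as. encodes_packing (set ss) w v as" for v
  proof -
    obtain as where as: "encodes_packing (set ss) w v as" using \<open>\<exists>as. _\<close> by blast
    show ?thesis
      \<comment> \<open>The leading \<open>Num 0\<close> has weight 0 and is just one more
        threshold; \<open>sweep_correct\<close> allows any list of them.\<close>
      using sweep_correct[OF sol ss as, where C = C and hs = "Num 0 # dec_list (enc_entries w ss)"] as
      unfolding f_def for_each_def Q_def by auto
  qed
  have start: "\<exists>as. encodes_packing (set ss) w (Num 0) as"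
    by (rule exI[of _ "[]"]) (simp add: encodes_packing_def enc_entries_def packings_def)
  have "length ss ^ 3 < Suc (length ss) ^ 3" by (intro power_strict_mono) auto
  then have "Q ((f ^^ (Suc (length ss) ^ 3)) (Num 0))"
    using funpow_fixpoint[of "\<lambda>v. \<exists>as. encodes_packing (set ss) w v as" f Q potential "length ss ^ 3",
        OF step _ start] potential_le[OF _ w] by blast
  then show thesis
    using that by (auto simp: Q_def local_search_funpow f_def[abs_def])
qed

section \<open>Rounding the weights\<close>

definition wnum :: "val \<Rightarrow> nat" where "wnum e = num (vfst (vsnd e))"
definition wden :: "val \<Rightarrow> nat" where "wden e = num (vsnd (vsnd e))"

text \<open>Fractions are compared by cross-multiplication, and \<open>vfst\<close> takes the first
  entry of maximal weight.\<close>

definition heaviest :: "val \<Rightarrow> val" where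
  "heaviest x = vfst (enc_list (filter
     (\<lambda>h. \<forall>e\<in>set (dec_list x). wnum e * wden h \<le> wnum h * wden e) (dec_list x)))"

text \<open>In integer arithmetic, this is the floor of \<open>n\<close> times the weight divided by
  the maximum weight, for \<open>n\<close> sets.\<close>

definition round_weights :: "val \<Rightarrow> val" where
  "round_weights x = enc_list (map (\<lambda>e. Pair (vfst e)
     (Num ((wnum e * length (dec_list x) * wden (heaviest x)) div (wden e * wnum (heaviest x))))) (dec_list x))"

lemma polytime_round_weights: "polytime D round_weights"
proof -
  have "polytime D (\<lambda>x. round_weights x)"
    unfolding round_weights_def heaviest_def wnum_def wden_def by (intro polytime_intros)
  then show ?thesis by simp
qed

definition rat_entry :: "(nat set \<Rightarrow> rat) \<Rightarrow> nat set \<Rightarrow> val" where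
  "rat_entry w s = Pair (enc_set s) (enc_rat (w s))"

lemma round_weights_map:
  fixes w ss defines "x \<equiv> enc_list (map (rat_entry w) ss)"
  shows "round_weights x = enc_entries (\<lambda>s. (wnum (rat_entry w s) * length ss * wden (heaviest x)) div
    (wden (rat_entry w s) * wnum (heaviest x))) ss"
proof -
  have "vfst (rat_entry w s) = enc_set s" for s by (simp add: rat_entry_def)
  then show ?thesis by (simp add: x_def round_weights_def enc_entries_def entry_def[abs_def] comp_def)
qed

lemma rat_entry_weight:
  assumes "0 < w s"
  shows "0 < wnum (rat_entry w s)" "0 < wden (rat_entry w s)"
    "real_of_rat (w s) = real (wnum (rat_entry w s)) / real (wden (rat_entry w s))"
proof -
  obtain a b where ab: "quotient_of (w s) = (a, b)" by fastforce
  have b: "0 < b" using quotient_of_denom_pos[OF ab] .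
  have q: "w s = of_int a / of_int b" using quotient_of_div[OF ab] .
  then have a: "0 < a" using assms b by (simp add: zero_less_divide_iff)
  have e: "wnum (rat_entry w s) = nat a" "wden (rat_entry w s) = nat b"
    by (simp_all add: rat_entry_def enc_rat_def ab wnum_def wden_def)
  show "0 < wnum (rat_entry w s)" "0 < wden (rat_entry w s)"
    using a b by (simp_all add: e)
  show "real_of_rat (w s) = real (wnum (rat_entry w s)) / real (wden (rat_entry w s))"
    unfolding e q using a b by (simp add: of_rat_divide)
qed

lemma heaviest_enc:
  assumes ss: "ss \<noteq> []" and w: "\<And>s. s \<in> set ss \<Longrightarrow> 0 < w s"
  obtains m where "m \<in> set ss" "\<And>s. s \<in> set ss \<Longrightarrow> w s \<le> w m"
    "heaviest (enc_list (map (rat_entry w) ss)) = rat_entry w m"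
proof -
  have iff: "wnum (rat_entry w s) * wden (rat_entry w t) \<le> wnum (rat_entry w t) * wden (rat_entry w s)
      \<longleftrightarrow> w s \<le> w t" if "s \<in> set ss" "t \<in> set ss" for s t
  proof -
    have "w s \<le> w t \<longleftrightarrow> real_of_rat (w s) \<le> real_of_rat (w t)" by (simp add: of_rat_less_eq)
    also have "\<dots> \<longleftrightarrow> real (wnum (rat_entry w s)) * real (wden (rat_entry w t)) \<le>
        real (wnum (rat_entry w t)) * real (wden (rat_entry w s))"
      unfolding rat_entry_weight(3)[of w, OF w[OF that(1)]] rat_entry_weight(3)[of w, OF w[OF that(2)]]
      using rat_entry_weight(1,2)[of w, OF w[OF that(1)]] rat_entry_weight(1,2)[of w, OF w[OF that(2)]]
      by (simp add: field_simps)
    finally show ?thesis unfolding of_nat_mult[symmetric] of_nat_le_iff by simp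
  qed
  have "Max (w ` set ss) \<in> w ` set ss" using ss by (intro Max_in) auto
  then obtain m0 where m0: "m0 \<in> set ss" "Max (w ` set ss) = w m0" by auto
  have top: "\<forall>s\<in>set ss. w s \<le> w m0" unfolding m0(2)[symmetric] by simp
  let ?x = "enc_list (map (rat_entry w) ss)"
  let ?ms = "filter (\<lambda>t. \<forall>s\<in>set ss. w s \<le> w t) ss"
  have "?ms \<noteq> []" using m0(1) top by (auto simp: filter_empty_conv)
  then obtain m ms where ms: "?ms = m # ms" by (cases ?ms) auto
  then have m: "m \<in> set ss" "\<forall>s\<in>set ss. w s \<le> w m"
    by (auto simp: filter_eq_Cons_iff)
  have "filter (\<lambda>h. \<forall>e\<in>set (dec_list ?x). wnum e * wden h \<le> wnum h * wden e) (dec_list ?x)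
      = map (rat_entry w) ?ms"
    using iff by (auto simp: filter_map comp_def intro!: arg_cong[of _ _ "map (rat_entry w)"] filter_cong)
  then have "heaviest ?x = rat_entry w m" unfolding heaviest_def by (simp add: ms)
  with m show thesis using that by blast
qed

text \<open>Scaling sends the heaviest weight exactly to \<open>n\<close>, and rounding down loses
  at most 1 per set, hence at most \<open>n\<close> on a packing.\<close>

lemma round_weights_enc:
  assumes ss: "ss \<noteq> []" and w: "\<And>s. s \<in> set ss \<Longrightarrow> 0 < w s"
  obtains w' m where "round_weights (enc_list (map (rat_entry w) ss)) = enc_entries w' ss"
    "m \<in> set ss" "w' m = length ss" "\<And>s. s \<in> set ss \<Longrightarrow> w' s \<le> length ss"
    "\<And>s. s \<in> set ss \<Longrightarrow> real (w' s) \<le> real_of_rat (w s) * (length ss / real_of_rat (w m))"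
    "\<And>s. s \<in> set ss \<Longrightarrow> real_of_rat (w s) * (length ss / real_of_rat (w m)) \<le> real (w' s) + 1"
proof -
  obtain m where m: "m \<in> set ss" "\<And>s. s \<in> set ss \<Longrightarrow> w s \<le> w m"
    "heaviest (enc_list (map (rat_entry w) ss)) = rat_entry w m"
    by (rule heaviest_enc[OF ss, of w], erule w, rule that)
  define a where "a s = wnum (rat_entry w s)" for s
  define b where "b s = wden (rat_entry w s)" for s
  define n where "n = length ss"
  define w' where "w' s = (a s * n * b m) div (b s * a m)" for s
  have ab: "0 < a s" "0 < b s" "real_of_rat (w s) = real (a s) / real (b s)" if "s \<in> set ss" for s
    using rat_entry_weight[of w s] w[OF that] by (simp_all add: a_def b_def)
  have quot: "real_of_rat (w s) * (real n / real_of_rat (w m)) = real (a s * n * b m) / real (b s * a m)"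
    if "s \<in> set ss" for s
    unfolding ab(3)[OF that] ab(3)[OF m(1)] using ab(1,2)[OF that] ab(1,2)[OF m(1)]
    by (simp add: field_simps)
  have low: "real (w' s) \<le> real_of_rat (w s) * (real n / real_of_rat (w m))" if "s \<in> set ss" for s
    unfolding quot[OF that] w'_def by (rule of_nat_div_le_of_nat)
  have up: "real_of_rat (w s) * (real n / real_of_rat (w m)) \<le> real (w' s) + 1" if "s \<in> set ss" for s
    unfolding quot[OF that] w'_def 
    using real_of_int_div3[of "int (a s * n * b m)" "int (b s * a m)"] unfolding zdiv_int[symmetric] by simp
  have "w' m = n" using ab[OF m(1)] by (simp add: w'_def mult_ac)
  moreover have "w' s \<le> n" if s: "s \<in> set ss" for s
  proof -
    have "real_of_rat (w s) \<le> real_of_rat (w m)" using m(2)[OF s] by (simp add: of_rat_less_eq)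
    then have "real_of_rat (w s) * (real n / real_of_rat (w m)) \<le> real_of_rat (w m) * (real n / real_of_rat (w m))"
      using w[OF m(1)] by (intro mult_right_mono) auto
    also have "\<dots> = real n" using w[OF m(1)] by simp
    finally show ?thesis using low[OF s] by simp
  qed
  moreover have "round_weights (enc_list (map (rat_entry w) ss)) = enc_entries w' ss"
    unfolding round_weights_map m(3) by (simp add: w'_def[abs_def] a_def b_def n_def)
  ultimately show thesis using that m(1) low up unfolding n_def by blast
qed

section \<open>The reduction\<close>

lemma finite_packings: "finite S \<Longrightarrow> finite (packings S)"
  by (rule finite_subset[of _ "Pow S"]) (auto simp: packings_def)

lemma sum_le_opt: "finite S \<Longrightarrow> B \<in> packings S \<Longrightarrow> (\<Sum>s\<in>B. w s) \<le> opt (S, w)"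
  by (auto simp: opt_def finite_packings intro!: Max_ge)

lemma opt_attained:
  assumes "finite S"
  obtains B where "B \<in> packings S" "opt (S, w) = (\<Sum>s\<in>B. w s)"
proof -
  have "{} \<in> packings S" by (simp add: packings_def)
  then have "opt (S, w) \<in> (\<lambda>A. \<Sum>s\<in>A. w s) ` packings S"
    unfolding opt_def prod.case using finite_packings[OF assms] by (intro Max_in) auto
  then show thesis using that by blast
qed

text \<open>The two assumptions provide possibly different runs, one with a time bound and one with
  a good output; determinism identifies their outputs.\<close>

lemma approx_solver_exists:
  assumes "polynomial_time (unweighted_instances k) p"
    and "approximation_algorithm (unweighted_instances k) r p" and r: "0 < r"
  obtains sol where "polytime {x. \<exists>I\<in>unweighted_instances k. encodes_instance x I} sol"
    "approx_solver k r sol"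
proof -
  obtain q :: "nat poly" where q: "\<And>I x. I \<in> unweighted_instances k \<Longrightarrow> encodes_instance x I \<Longrightarrow>
      \<exists>y t. runs p x y t \<and> t \<le> poly q (vsize x)"
    using assms(1) unfolding polynomial_time_def by blast
  define sol where "sol x = (SOME y. \<exists>t. runs p x y t \<and> t \<le> poly q (vsize x))" for x
  have sol: "\<exists>t. runs p x (sol x) t \<and> t \<le> poly q (vsize x)"
    if "I \<in> unweighted_instances k" "encodes_instance x I" for x I
    unfolding sol_def using q[OF that] by (rule someI_ex)
  show thesis
  proof
    show "polytime {x. \<exists>I\<in>unweighted_instances k. encodes_instance x I} sol"
      by (rule polytimeI[where p = p and q = q]) (use sol in blast)
    show "approx_solver k r sol"
      unfolding approx_solver_def
    proof (intro allI impI)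
      fix x S assume S: "(S, \<lambda>_. 1) \<in> unweighted_instances k" and x: "encodes_instance x (S, \<lambda>_. 1)"
      have "\<forall>x. encodes_instance x (S, \<lambda>_. 1) \<longrightarrow>
          (\<exists>y t A. runs p x y t \<and> encodes_collection y A \<and> A \<in> packings S \<and>
            real_of_rat (\<Sum>s\<in>A. 1) \<ge> 1 / r * real_of_rat (opt (S, \<lambda>_. 1)))"
        using bspec[OF assms(2)[unfolded approximation_algorithm_def] S] by (simp only: prod.case)
      with x obtain y t A where A: "runs p x y t" "encodes_collection y A" "A \<in> packings S"
        "real_of_rat (\<Sum>s\<in>A. 1) \<ge> 1 / r * real_of_rat (opt (S, \<lambda>_. 1))"
        by blast
      have "y = sol x" using sol[OF S x] A(1) runs_deterministic by blast
      have fin: "finite S" using S by (simp add: unweighted_instances_def weighted_instances_def)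
      have "real (card B) \<le> r * real (card A)" if "B \<in> packings S" for B
      proof -
        have "real_of_rat (\<Sum>s\<in>B. 1) \<le> real_of_rat (opt (S, \<lambda>_. 1))"
          unfolding of_rat_less_eq using sum_le_opt[OF fin that] .
        then have "real (card B) \<le> real_of_rat (opt (S, \<lambda>_. 1))" by simp
        also have "\<dots> \<le> r * real (card A)" using A(4) r by (simp add: field_simps)
        finally show ?thesis .
      qed
      then show "\<exists>A. encodes_collection (sol x) A \<and> A \<in> packings S \<and>
          (\<forall>B\<in>packings S. real (card B) \<le> r * real (card A))"
        using A(2,3) \<open>y = sol x\<close> by blast
    qed
  qed
qed

definition reduction :: "nat \<Rightarrow> (val \<Rightarrow> val) \<Rightarrow> val \<Rightarrow> val" where
  "reduction C sol x = enc_list (map vfst (dec_list (local_search C sol (round_weights x))))"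

text \<open>The factor 2 in \<open>bound\<close> pays for rounding: the optimum loses at most
  \<open>n\<close>, and \<open>n\<close> is itself at most \<open>K\<close> times the rounded weight
  of the local optimum.\<close>

lemma reduction_correct:
  assumes sol: "approx_solver k r sol" and r: "0 \<le> r" and k: "1 \<le> k" and C: "1 \<le> C"
    and bound: "2 * (real k / real C + 64 * real C ^ 3 * r) \<le> R"
    and S: "(S, w) \<in> weighted_instances k" and x: "encodes_instance x (S, w)"
  obtains A where "encodes_collection (reduction C sol x) A" "A \<in> packings S"
    "real_of_rat (opt (S, w)) \<le> R * real_of_rat (\<Sum>s\<in>A. w s)"
proof -
  obtain ss where ss: "distinct ss" "set ss = S" "x = enc_list (map (rat_entry w) ss)"
    using x by (auto simp: encodes_instance_def rat_entry_def[abs_def])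
  have sets: "\<forall>s\<in>set ss. finite s \<and> card s \<le> k" and w: "\<And>s. s \<in> set ss \<Longrightarrow> 0 < w s"
    using S ss(2) by (auto simp: weighted_instances_def)
  define K where "K = real k / real C + 64 * real C ^ 3 * r"
  have K: "0 \<le> K" "2 * K \<le> R" using r bound by (simp_all add: K_def)
  have solve: "\<exists>as. set as \<in> packings S \<and> distinct as \<and> encodes_collection (reduction C sol x) (set as) \<and>
      (\<forall>B\<in>packings S. real (\<Sum>b\<in>B. w' b) \<le> K * real (\<Sum>a\<in>set as. w' a))"
    if w': "round_weights x = enc_entries w' ss" "\<forall>s\<in>set ss. w' s \<le> length ss" for w'
  proof -
    obtain as where as: "encodes_packing (set ss) w' (local_search C sol (enc_entries w' ss)) as"
      and stuck: "\<And>s. s \<in> set ss \<Longrightarrow> \<exists>X. blocking (set ss) w' C r (set as) (w' s) X"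
      by (rule local_search_correct[OF sol ss(1) sets w'(2)]) (rule that)
    have "reduction C sol x = enc_list (map enc_set as)"
      using as by (simp add: reduction_def w'(1) encodes_packing_def comp_def)
    then have "encodes_collection (reduction C sol x) (set as)"
      using as by (auto simp: encodes_collection_def encodes_packing_def)
    moreover have "real (\<Sum>b\<in>B. w' b) \<le> K * real (\<Sum>a\<in>set as. w' a)" if "B \<in> packings S" for B
      unfolding K_def
    proof (rule local_optimum_bound[where S = "set ss"])
      show "set as \<in> packings (set ss)" using as by (simp add: encodes_packing_def)
      show "B \<in> packings (set ss)" using that ss(2) by simp
    qed (use sets k C r stuck in simp_all)
    ultimately show ?thesis using as ss(2) by (auto simp: encodes_packing_def)
  qed
  have finS: "finite S" using ss(2) by auto
  obtain B where B: "B \<in> packings S" "opt (S, w) = (\<Sum>s\<in>B. w s)"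
    by (rule opt_attained[OF finS]) (rule that)
  have B_sub: "B \<subseteq> set ss" using B(1) ss(2) by (auto simp: packings_def)
  show thesis
  \<comment> \<open>Without sets there is no heaviest one to scale by, and both sides are 0.\<close>
  proof (cases "ss = []")
    case True
    have "round_weights x = enc_entries (\<lambda>_. 0) ss"
      by (simp add: True ss(3) round_weights_def enc_entries_def)
    from solve[OF this] obtain as where "set as \<in> packings S" "encodes_collection (reduction C sol x) (set as)"
      by auto
    moreover have "opt (S, w) = 0" "set as = {}"
      using True B B_sub ss(2) \<open>set as \<in> packings S\<close> by (auto simp: packings_def)
    ultimately show thesis using that[of "set as"] by simp
  next
    case False
    obtain w' m where w': "round_weights x = enc_entries w' ss"
      and m: "m \<in> set ss" "w' m = length ss"
      and w'_le: "\<And>s. s \<in> set ss \<Longrightarrow> w' s \<le> length ss"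
      and low: "\<And>s. s \<in> set ss \<Longrightarrow> real (w' s) \<le> real_of_rat (w s) * (length ss / real_of_rat (w m))"
      and up: "\<And>s. s \<in> set ss \<Longrightarrow> real_of_rat (w s) * (length ss / real_of_rat (w m)) \<le> real (w' s) + 1"
      by (rule round_weights_enc[OF False, of w, folded ss(3)], erule w, rule that)
    define c where "c = length ss / real_of_rat (w m)"
    have c: "0 < c" using False w[OF m(1)] by (simp add: c_def)
    obtain as where as: "set as \<in> packings S" "distinct as"
        "encodes_collection (reduction C sol x) (set as)"
      and best: "\<And>B. B \<in> packings S \<Longrightarrow> real (\<Sum>b\<in>B. w' b) \<le> K * real (\<Sum>a\<in>set as. w' a)"
      using solve[OF w'] w'_le by blast
    have as_sub: "set as \<subseteq> set ss" using as(1) ss(2) by (auto simp: packings_def)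
    \<comment> \<open>Comparison with this one-set packing of rounded weight \<open>n\<close>
      absorbs the rounding loss.\<close>
    have "{m} \<in> packings S" using m(1) ss(2) by (simp add: packings_def)
    from best[OF this] have n: "real (length ss) \<le> K * real (\<Sum>a\<in>set as. w' a)" using m(2) by simp
    have "real_of_rat (opt (S, w)) * c = (\<Sum>b\<in>B. real_of_rat (w b) * c)"
      by (simp add: B(2) of_rat_sum sum_distrib_right)
    also have "\<dots> \<le> (\<Sum>b\<in>B. real (w' b) + 1)"
      using up B_sub by (intro sum_mono) (auto simp: c_def)
    also have "\<dots> = real (\<Sum>b\<in>B. w' b) + real (card B)" by (simp add: sum.distrib)
    also have "real (card B) \<le> real (length ss)"
      using card_mono[OF _ B_sub] card_length[of ss] by simp
    also have "real (\<Sum>b\<in>B. w' b) + real (length ss) \<le> 2 * K * real (\<Sum>a\<in>set as. w' a)"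
      using best[OF B(1)] n by simp
    also have "\<dots> \<le> R * real (\<Sum>a\<in>set as. w' a)" using K(2) by (intro mult_right_mono of_nat_0_le_iff)
    also have "\<dots> \<le> R * (\<Sum>a\<in>set as. real_of_rat (w a) * c)"
      unfolding of_nat_sum using low as_sub K by (intro mult_left_mono sum_mono) (auto simp: c_def)
    also have "\<dots> = R * real_of_rat (\<Sum>a\<in>set as. w a) * c"
      by (simp add: of_rat_sum sum_distrib_right mult.assoc)
    finally have "real_of_rat (opt (S, w)) \<le> R * real_of_rat (\<Sum>a\<in>set as. w a)" using c by simp
    then show thesis using that as by blast
  qed
qed

lemma polytime_reduction:
  assumes sol: "polytime {x. \<exists>I\<in>unweighted_instances k. encodes_instance x I} sol"
  shows "polytime {x. \<exists>I\<in>weighted_instances k. encodes_instance x I} (reduction C sol)"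
proof -
  define V where "V = {enc_entries w ss |w ss. distinct ss \<and> (\<forall>s\<in>set ss. finite s \<and> card s \<le> k)}"
  \<comment> \<open>For arbitrary \<open>h\<close> and \<open>A\<close> the candidate list is still
    a sublist of \<open>L\<close>, and this alone makes the unit instance legal.\<close>
  have call: "unit_instance (candidate_list C (wt h) A L) \<in> {x. \<exists>I\<in>unweighted_instances k. encodes_instance x I}"
    if L: "L \<in> V" for h A L
  proof -
    obtain w ss where ss: "L = enc_entries w ss" "distinct ss" "\<forall>s\<in>set ss. finite s \<and> card s \<le> k"
      using L by (auto simp: V_def)
    obtain cs where cs: "candidate_list C (wt h) A L = enc_entries w cs" "distinct cs" "set cs \<subseteq> set ss"
    proof
      let ?P = "\<lambda>e. wt h \<le> wt e \<and> wt e < 2 * wt h \<and>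
        (\<Sum>a\<leftarrow>dec_list A. if clash a e then wt a else 0) \<le> C * wt e"
      show "candidate_list C (wt h) A L = enc_entries w (filter (?P \<circ> entry w) ss)"
        unfolding candidate_list_def ss(1) dec_enc_entries by (simp only: filter_map enc_entries_def)
    qed (use ss in auto)
    have "(set cs, \<lambda>_. 1) \<in> unweighted_instances k"
      using ss(3) cs(3) by (auto simp: unweighted_instances_def weighted_instances_def)
    then show ?thesis using unit_instance_enc[OF cs(2), of w] cs(1) by auto
  qed
  have "round_weights x \<in> V" if S: "(S, w) \<in> weighted_instances k" and x: "encodes_instance x (S, w)" for x S w
  proof -
    obtain ss where ss: "distinct ss" "set ss = S" "x = enc_list (map (rat_entry w) ss)"
      using x by (auto simp: encodes_instance_def rat_entry_def[abs_def])
    have "set ss = S" "distinct ss" "\<exists>w'. round_weights x = enc_entries w' ss"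
      using ss round_weights_map by auto
    then show ?thesis using S by (auto simp: V_def weighted_instances_def)
  qed
  then have "polytime {x. \<exists>I\<in>weighted_instances k. encodes_instance x I} (\<lambda>x. local_search C sol (round_weights x))"
    by (intro polytime_comp[OF polytime_local_search[OF sol call] polytime_round_weights]) auto
  then show ?thesis
    unfolding reduction_def by (intro polytime_map polytime_apply polytime_id)
qed

theorem theorem5:
  fixes \<sigma> :: real
  assumes "0 < \<sigma>" and "\<sigma> < 1"
  shows "\<exists>\<tau>::real. 0 < \<tau> \<and> \<tau> < 1 \<and>
    (\<forall>k0::nat. k0 \<ge> 3 \<longrightarrow>
      (\<forall>k\<ge>k0. \<exists>p. polynomial_time (unweighted_instances k) p \<and>
         approximation_algorithm (unweighted_instances k) (\<tau> * (real k + 1)) p) \<longrightarrow>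
      (\<forall>k\<ge>k0. \<exists>p. polynomial_time (weighted_instances k) p \<and>
         approximation_algorithm (weighted_instances k) (1 + \<sigma> * (real k - 1)) p))"
proof -
  \<comment> \<open>With \<open>C \<ge> 4 / \<sigma>\<close> the sets with heavy neighbourhoods cost
    at most \<open>\<sigma> * k / 4\<close>.\<close>
  define C where "C = nat \<lceil>4 / \<sigma>\<rceil>"
  \<comment> \<open>Here 512 is 64 times 8: the term \<open>64 * C ^ 3 * r\<close> becomes
    \<open>\<sigma> * (k + 1) / 8\<close>, again at most \<open>\<sigma> * k / 4\<close> since
    \<open>k \<ge> 1\<close>.\<close>
  define \<tau> where "\<tau> = \<sigma> / (512 * real C ^ 3)"
  have C_ge: "4 / \<sigma> \<le> real C" unfolding C_def by (rule real_nat_ceiling_ge)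
  have "1 \<le> 4 / \<sigma>" using assms by simp
  then have C: "1 \<le> real C" using C_ge by linarith
  have \<tau>: "0 < \<tau>" using assms C by (simp add: \<tau>_def)
  have "1 \<le> real C ^ 3" using C by simp
  then have "\<sigma> < 512 * real C ^ 3" using assms by linarith
  then have "\<tau> < 1" using C by (simp add: \<tau>_def)
  have "\<exists>p. polynomial_time (weighted_instances k) p \<and>
      approximation_algorithm (weighted_instances k) (1 + \<sigma> * (real k - 1)) p"
    if k: "1 \<le> k" and p0: "polynomial_time (unweighted_instances k) p0"
      "approximation_algorithm (unweighted_instances k) (\<tau> * (real k + 1)) p0" for k p0
  proof -
    let ?r = "\<tau> * (real k + 1)" and ?R = "1 + \<sigma> * (real k - 1)"
    have r: "0 < ?r" using \<tau> by simp
    obtain sol where sol: "polytime {x. \<exists>I\<in>unweighted_instances k. encodes_instance x I} sol"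
        "approx_solver k ?r sol"
      by (rule approx_solver_exists[OF p0 r]) (rule that)
    have "4 * real k \<le> (\<sigma> * real C) * real k"
      using C_ge assms(1) by (intro mult_right_mono) (simp_all add: field_simps)
    then have 1: "real k / real C \<le> \<sigma> * real k / 4" using C by (simp add: field_simps)
    have "64 * real C ^ 3 * ?r = \<sigma> / 8 * (real k + 1)" using C by (simp add: \<tau>_def field_simps)
    also have "\<dots> \<le> \<sigma> / 8 * (2 * real k)" using assms(1) k by (intro mult_left_mono) auto
    finally have 2: "64 * real C ^ 3 * ?r \<le> \<sigma> * real k / 4" by simp
    have "2 * (real k / real C + 64 * real C ^ 3 * ?r) \<le> 2 * (\<sigma> * real k / 4 + \<sigma> * real k / 4)"
      by (intro mult_left_mono add_mono 1 2) simp
    also have "\<dots> = \<sigma> * real k" by simp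
    \<comment> \<open>The gap between the two sides is \<open>1 - \<sigma>\<close>.\<close>
    also have "\<dots> \<le> ?R" using assms(2) by (simp add: algebra_simps)
    finally have bound: "2 * (real k / real C + 64 * real C ^ 3 * ?r) \<le> ?R" .
    have R: "0 < ?R" using assms(1) k by (simp add: add_pos_nonneg)
    obtain p and q :: "nat poly" where p: "\<And>x. x \<in> {x. \<exists>I\<in>weighted_instances k. encodes_instance x I} \<Longrightarrow>
        \<exists>t. runs p x (reduction C sol x) t \<and> t \<le> poly q (vsize x)"
      by (rule polytimeE[OF polytime_reduction[OF sol(1)]]) (rule that)
    have "polynomial_time (weighted_instances k) p"
      unfolding polynomial_time_def using p by blast
    moreover have "approximation_algorithm (weighted_instances k) ?R p"
      unfolding approximation_algorithm_def
    proof (clarify)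
      fix S w x assume S: "(S, w) \<in> weighted_instances k" and x: "encodes_instance x (S, w)"
      obtain A where A: "encodes_collection (reduction C sol x) A" "A \<in> packings S"
        "real_of_rat (opt (S, w)) \<le> ?R * real_of_rat (\<Sum>s\<in>A. w s)"
        using reduction_correct[OF sol(2) less_imp_le[OF r] k _ bound S x] C by auto
      have "1 / ?R * real_of_rat (opt (S, w)) \<le> real_of_rat (\<Sum>s\<in>A. w s)"
        using A(3) R by (simp add: field_simps)
      then show "\<exists>y t A. runs p x y t \<and> encodes_collection y A \<and> A \<in> packings S \<and>
          1 / ?R * real_of_rat (opt (S, w)) \<le> real_of_rat (\<Sum>s\<in>A. w s)"
        using p S x A by blast
    qed
    ultimately show ?thesis by blast
  qed
  then show ?thesis using \<tau> \<open>\<tau> < 1\<close> by (intro exI[of _ \<tau>] conjI allI impI) fastforce+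
qed

end
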